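(* Let $E$ be a Banach lattice with dual $E'$, and let $A\subset E$ and $B\subset E'$ be bounded solid subsets. Then the following hold. (1) If $E$ has order continuous norm, then the following conditions are equivalent. (a) $A$ is L-weakly compact. (b) For every positive disjoint sequence $(x_n)$ in $A$ and each bounded $uaw^*$-null sequence $(x'_n)$ in $E'$, $x'_n(x_n)\to 0$. (c) For every positive disjoint sequence $(x_n)$ in $A$ and each bounded $uaw$-null sequence $(x'_n)$ in $E'$, $x'_n(x_n)\to 0$. (d) For every positive disjoint sequence $(x_n)$ in $A$ and each bounded $uo$-null sequence $(x'_n)$ in $E'$, $x'_n(x_n)\to 0$. (2) If $E'$ has order continuous norm, then $B$ is L-weakly compact if and only if $x'_n(x_n)\to 0$ for every positive disjoint sequence $(x'_n)\subset B$ and each bounded $uaw$-null sequence $(x_n)$ in $E$.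
   Context: A bounded subset $A$ of a Banach lattice is L-weakly compact if every disjoint sequence in the solid hull of $A$ converges to zero in norm (a sequence $(x_n)$ is disjoint if $|x_n|\wedge|x_m|=0$ for $n\neq m$). A net $(x_\alpha)$ in a Riesz space is order convergent to $x$ if there is a net $(y_\beta)$, possibly over a different index set, with $y_\beta\downarrow 0$ such that for each $\beta$ there is $\alpha_0$ with $|x_\alpha-x|\le y_\beta$ for all $\alpha\ge\alpha_0$. In a Banach lattice $G$, a net $(x_\alpha)$ is $uo$-convergent (unbounded order convergent), respectively $uaw$-convergent (unbounded absolute weakly convergent), to $x$ if for every $u\in G_+$ the net $|x_\alpha-x|\wedge u$ converges to $0$ in order, respectively weakly, i.e. in $\sigma(G,G')$. In a dual Banach lattice $E'$, a net $(x'_\alpha)$ is $uaw^*$-convergent (unbounded absolute weak* convergent) to $x'$ if $|x'_\alpha-x'|\wedge u'\to 0$ in $\sigma(E',E)$ for every $u'\in E'_+$. A sequence is $uo$-, $uaw$- or $uaw^*$-null if it converges to $0$ in the respective sense. "Bounded" means norm bounded. *)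

theory Defs
  imports "HOL-Analysis.Analysis" "HOL-Library.Lattice_Algebras"
begin

section \<open>Banach lattices\<close>

text \<open>
  The modulus is the lattice one, \<open>\<bar>x\<bar> = sup x (- x)\<close>; this is the axiom of the class
  \<^class>\<open>lattice_ab_group_add_abs\<close>.
\<close>

class banach_lattice = banach + lattice_ab_group_add_abs + ordered_real_vector +
  assumes norm_le_if_abs_le: "\<bar>x\<bar> \<le> \<bar>y\<bar> \<Longrightarrow> norm x \<le> norm y"

lemma norm_abs_eq [simp]: "norm \<bar>x\<bar> = norm x" for x :: "'a::banach_lattice"
  by (intro order.antisym norm_le_if_abs_le) simp_all

lemma norm_mono_pos: "0 \<le> x \<Longrightarrow> x \<le> y \<Longrightarrow> norm x \<le> norm y" for x :: "'a::banach_lattice"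
  by (rule norm_le_if_abs_le) (metis abs_of_nonneg order_trans)

lemma pprt_le_abs: "pprt x \<le> \<bar>x\<bar>" for x :: "'a::banach_lattice"
  by (simp add: pprt_def abs_ge_self)

lemma norm_pprt_le: "norm (pprt x) \<le> norm x" for x :: "'a::banach_lattice"
  using norm_mono_pos[OF zero_le_pprt pprt_le_abs, of x] by simp

lemma pprt_diff_pprt_minus: "pprt x - pprt (- x) = x" for x :: "'a::banach_lattice"
  by (simp add: pprt_neg flip: prts)


section \<open>The dual Banach lattice\<close>

text \<open>
  A copy of the Banach space \<^typ>\<open>'a \<Rightarrow>\<^sub>L real\<close> of bounded linear functionals with the operator
  norm. The copy is needed because a class instance for \<^typ>\<open>'a \<Rightarrow>\<^sub>L 'b\<close> cannot be restricted to
  real values, and the bounded operators into a general \<^typ>\<open>'b\<close> do not form a Banach lattice.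
\<close>

typedef (overloaded) 'a dual = "UNIV :: ('a::real_normed_vector \<Rightarrow>\<^sub>L real) set"
  morphisms blinfun_of_dual dual_of_blinfun ..

setup_lifting type_definition_dual

abbreviation dual_apply :: "'a::real_normed_vector dual \<Rightarrow> 'a \<Rightarrow> real" where
  "dual_apply f x \<equiv> blinfun_apply (blinfun_of_dual f) x"

lemma dual_eqI: "(\<And>x. dual_apply f x = dual_apply g x) \<Longrightarrow> f = g"
  by (simp add: blinfun_eqI flip: blinfun_of_dual_inject)

instantiation dual :: (real_normed_vector) real_normed_vector
begin

lift_definition norm_dual :: "'a dual \<Rightarrow> real" is norm .
lift_definition minus_dual :: "'a dual \<Rightarrow> 'a dual \<Rightarrow> 'a dual" is minus .
lift_definition uminus_dual :: "'a dual \<Rightarrow> 'a dual" is uminus .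
lift_definition zero_dual :: "'a dual" is 0 .
lift_definition plus_dual :: "'a dual \<Rightarrow> 'a dual \<Rightarrow> 'a dual" is plus .
lift_definition scaleR_dual :: "real \<Rightarrow> 'a dual \<Rightarrow> 'a dual" is scaleR .
lift_definition sgn_dual :: "'a dual \<Rightarrow> 'a dual" is sgn .
lift_definition dist_dual :: "'a dual \<Rightarrow> 'a dual \<Rightarrow> real" is dist .

definition uniformity_dual :: "('a dual \<times> 'a dual) filter" where
  "uniformity_dual = (INF e\<in>{0 <..}. principal {(x, y). dist x y < e})"

definition open_dual :: "'a dual set \<Rightarrow> bool" where
  "open_dual S = (\<forall>x\<in>S. \<forall>\<^sub>F (x', y) in uniformity. x' = x \<longrightarrow> y \<in> S)"

instance
proof
  fix x y z :: "'a dual" and a b :: real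
  show "dist x y = norm (x - y)" by transfer (rule dist_norm)
  show "sgn x = inverse (norm x) *\<^sub>R x" by transfer (rule sgn_div_norm)
  show "uniformity = (INF e\<in>{0<..}. principal {(x, y :: 'a dual). dist x y < e})"
    by (rule uniformity_dual_def)
  show "open U = (\<forall>x\<in>U. \<forall>\<^sub>F (x', y) in uniformity. x' = x \<longrightarrow> y \<in> U)" for U :: "'a dual set"
    by (rule open_dual_def)
  show "norm (x + y) \<le> norm x + norm y" by transfer (rule norm_triangle_ineq)
qed (transfer, simp add: algebra_simps)+

end

lemma dual_apply_simps [simp]:
  "dual_apply 0 x = 0"
  "dual_apply (f + g) x = dual_apply f x + dual_apply g x"
  "dual_apply (f - g) x = dual_apply f x - dual_apply g x"
  "dual_apply (- f) x = - dual_apply f x"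
  "dual_apply (r *\<^sub>R f) x = r * dual_apply f x"
  by (simp_all add: zero_dual.rep_eq plus_dual.rep_eq minus_dual.rep_eq uminus_dual.rep_eq
      scaleR_dual.rep_eq blinfun.bilinear_simps)

lemma abs_dual_apply_le: "\<bar>dual_apply f x\<bar> \<le> norm f * norm x"
  using norm_blinfun[of "blinfun_of_dual f" x] by (simp add: norm_dual.rep_eq)

instance dual :: (real_normed_vector) banach
proof
  fix X :: "nat \<Rightarrow> 'a dual"
  assume "Cauchy X"
  then have "Cauchy (\<lambda>n. blinfun_of_dual (X n))"
    by (simp add: Cauchy_def dist_dual.rep_eq)
  then obtain l where "(\<lambda>n. blinfun_of_dual (X n)) \<longlonglongrightarrow> l"
    using Cauchy_convergent convergent_def by blast
  then have "X \<longlonglongrightarrow> dual_of_blinfun l"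
    by (simp add: tendsto_iff dist_dual.rep_eq dual_of_blinfun_inverse)
  then show "convergent X"
    by (auto simp: convergent_def)
qed

text \<open>The positive part of a functional, by the Riesz--Kantorovich formula.\<close>

definition cone_sup :: "'a::banach_lattice dual \<Rightarrow> 'a \<Rightarrow> real" where
  "cone_sup f x = Sup (dual_apply f ` {0..x})"

lemma dual_apply_interval_le:
  fixes x :: "'a::banach_lattice"
  assumes "y \<in> {0..x}" shows "dual_apply f y \<le> norm f * norm x"
proof -
  have "dual_apply f y \<le> norm f * norm y"
    using abs_dual_apply_le[of f y] by simp
  also have "\<dots> \<le> norm f * norm x"
    using assms norm_mono_pos[of y x] by (intro mult_left_mono) (auto simp: norm_dual.rep_eq)
  finally show ?thesis .
qed

lemma cone_sup_upper: "y \<in> {0..x} \<Longrightarrow> dual_apply f y \<le> cone_sup f x"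
  unfolding cone_sup_def
  by (intro cSup_upper imageI) (auto intro!: bdd_aboveI2 dual_apply_interval_le)

lemma cone_sup_least:
  "0 \<le> x \<Longrightarrow> (\<And>y. y \<in> {0..x} \<Longrightarrow> dual_apply f y \<le> c) \<Longrightarrow> cone_sup f x \<le> c"
  unfolding cone_sup_def by (intro cSup_least) auto

lemma cone_sup_nonneg: "0 \<le> x \<Longrightarrow> 0 \<le> cone_sup f x"
  using cone_sup_upper[of 0 x f] by (simp add: blinfun.bilinear_simps)

lemma cone_sup_le_norm: "0 \<le> x \<Longrightarrow> cone_sup f x \<le> norm f * norm x"
  by (intro cone_sup_least dual_apply_interval_le)

lemma cone_sup_add:
  fixes x y :: "'a::banach_lattice"
  assumes "0 \<le> x" "0 \<le> y"
  shows "cone_sup f (x + y) = cone_sup f x + cone_sup f y"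
proof (rule order.antisym)
  show "cone_sup f (x + y) \<le> cone_sup f x + cone_sup f y"
  proof (rule cone_sup_least)
    fix z assume z: "z \<in> {0..x + y}"
    have "z - inf z x = sup 0 (z - x)"
      by (simp add: diff_inf_eq_sup add_sup_distrib_left)
    also have "\<dots> \<le> y"
      using z assms by (simp add: algebra_simps)
    finally have "z - inf z x \<le> y" .
    moreover have "0 \<le> z - inf z x"
      unfolding diff_ge_0_iff_ge by simp
    ultimately have "z - inf z x \<in> {0..y}"
      unfolding atLeastAtMost_iff by blast
    moreover have "inf z x \<in> {0..x}"
      using z assms by simp
    ultimately have "dual_apply f (inf z x) + dual_apply f (z - inf z x) \<le> cone_sup f x + cone_sup f y"
      by (intro add_mono cone_sup_upper)
    then show "dual_apply f z \<le> cone_sup f x + cone_sup f y"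
      unfolding blinfun.diff_right by simp
  qed (use assms in simp)
next
  have "dual_apply f u + dual_apply f v \<le> cone_sup f (x + y)" if "u \<in> {0..x}" "v \<in> {0..y}" for u v
    using cone_sup_upper[of "u + v" "x + y" f] that
    by (auto simp: blinfun.bilinear_simps intro: add_mono)
  note uv = this
  have "dual_apply f u \<le> cone_sup f (x + y) - cone_sup f y" if "u \<in> {0..x}" for u
  proof -
    have "dual_apply f v \<le> cone_sup f (x + y) - dual_apply f u" if "v \<in> {0..y}" for v
      using uv[OF \<open>u \<in> {0..x}\<close> that] by linarith
    from cone_sup_least[OF assms(2) this] show ?thesis
      by linarith
  qed
  then have "cone_sup f x \<le> cone_sup f (x + y) - cone_sup f y"
    by (intro cone_sup_least assms)
  then show "cone_sup f x + cone_sup f y \<le> cone_sup f (x + y)"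
    by simp
qed

lemma cone_sup_scaleR_le:
  assumes "0 < r" "0 \<le> x"
  shows "r * cone_sup f x \<le> cone_sup f (r *\<^sub>R x)"
proof -
  have "cone_sup f x \<le> cone_sup f (r *\<^sub>R x) / r"
  proof (rule cone_sup_least)
    fix y assume "y \<in> {0..x}"
    then have "r *\<^sub>R y \<in> {0..r *\<^sub>R x}"
      using assms by (auto intro: scaleR_left_mono scaleR_nonneg_nonneg)
    from cone_sup_upper[OF this, of f]
    show "dual_apply f y \<le> cone_sup f (r *\<^sub>R x) / r"
      using assms by (simp add: blinfun.bilinear_simps field_simps)
  qed fact
  then show ?thesis
    using assms by (simp add: field_simps)
qed

lemma cone_sup_scaleR:
  assumes "0 \<le> r" "0 \<le> x"
  shows "cone_sup f (r *\<^sub>R x) = r * cone_sup f x"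
proof (cases "r = 0")
  case True
  then show ?thesis
    by (simp add: cone_sup_def)
next
  case False
  with assms have r: "0 < r" by simp
  have "inverse r * cone_sup f (r *\<^sub>R x) \<le> cone_sup f (inverse r *\<^sub>R r *\<^sub>R x)"
    using r assms by (intro cone_sup_scaleR_le) (auto intro: scaleR_nonneg_nonneg)
  then have "cone_sup f (r *\<^sub>R x) \<le> r * cone_sup f x"
    using r by (simp add: field_simps)
  with cone_sup_scaleR_le[OF r assms(2), of f] show ?thesis
    by simp
qed

definition pos_part_fun :: "'a::banach_lattice dual \<Rightarrow> 'a \<Rightarrow> real" where
  "pos_part_fun f x = cone_sup f (pprt x) - cone_sup f (pprt (- x))"

lemma pos_part_fun_diff:
  assumes "0 \<le> a" "0 \<le> b"
  shows "pos_part_fun f (a - b) = cone_sup f a - cone_sup f b"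
proof -
  have "pprt (a - b) - pprt (- (a - b)) = a - b"
    by (rule pprt_diff_pprt_minus)
  then have "pprt (a - b) + b = pprt (- (a - b)) + a"
    by (simp add: algebra_simps)
  then have "cone_sup f (pprt (a - b) + b) = cone_sup f (pprt (- (a - b)) + a)"
    by simp
  then show ?thesis
    using assms by (simp add: cone_sup_add pos_part_fun_def)
qed

lemma bounded_linear_pos_part_fun: "bounded_linear (pos_part_fun f)"
proof (rule bounded_linear_intro)
  fix x y :: 'a and r :: real
  have "x + y = (pprt x - pprt (- x)) + (pprt y - pprt (- y))"
    by (simp only: pprt_diff_pprt_minus)
  also have "\<dots> = (pprt x + pprt y) - (pprt (- x) + pprt (- y))"
    by (simp only: algebra_simps)
  finally have "pos_part_fun f (x + y) = pos_part_fun f \<dots>"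
    by simp
  also have "\<dots> = cone_sup f (pprt x + pprt y) - cone_sup f (pprt (- x) + pprt (- y))"
    by (intro pos_part_fun_diff add_nonneg_nonneg zero_le_pprt)
  finally show "pos_part_fun f (x + y) = pos_part_fun f x + pos_part_fun f y"
    by (simp add: cone_sup_add pos_part_fun_def)
  have pos: "pos_part_fun f (s *\<^sub>R z) = s * pos_part_fun f z" if "0 \<le> s" for s z
  proof -
    have "s *\<^sub>R z = s *\<^sub>R (pprt z - pprt (- z))"
      by (simp only: pprt_diff_pprt_minus)
    also have "\<dots> = s *\<^sub>R pprt z - s *\<^sub>R pprt (- z)"
      by (simp only: scaleR_diff_right)
    finally have "pos_part_fun f (s *\<^sub>R z) = pos_part_fun f \<dots>"
      by simp
    also have "\<dots> = cone_sup f (s *\<^sub>R pprt z) - cone_sup f (s *\<^sub>R pprt (- z))"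
      using that by (intro pos_part_fun_diff scaleR_nonneg_nonneg zero_le_pprt)
    finally show ?thesis
      using that by (simp add: cone_sup_scaleR pos_part_fun_def right_diff_distrib)
  qed
  have minus: "pos_part_fun f (- z) = - pos_part_fun f z" for z
    by (simp add: pos_part_fun_def)
  show "pos_part_fun f (r *\<^sub>R x) = r *\<^sub>R pos_part_fun f x"
  proof (cases "0 \<le> r")
    case False
    then have "pos_part_fun f ((- r) *\<^sub>R (- x)) = (- r) * pos_part_fun f (- x)"
      by (intro pos) simp
    then show ?thesis
      by (simp add: minus)
  qed (simp add: pos)
  have bd: "cone_sup f (pprt z) \<le> norm f * norm z" for z
  proof -
    have "cone_sup f (pprt z) \<le> norm f * norm (pprt z)"
      by (intro cone_sup_le_norm zero_le_pprt)
    also have "\<dots> \<le> norm f * norm z"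
      by (intro mult_left_mono norm_pprt_le) simp
    finally show ?thesis .
  qed
  show "norm (pos_part_fun f x) \<le> norm x * norm f"
    using bd[of x] bd[of "- x"] cone_sup_nonneg[OF zero_le_pprt, of f x]
      cone_sup_nonneg[OF zero_le_pprt, of f "- x"]
    by (simp add: pos_part_fun_def abs_le_iff mult.commute)
qed

definition dual_pos_part :: "'a::banach_lattice dual \<Rightarrow> 'a dual" where
  "dual_pos_part f = dual_of_blinfun (Blinfun (pos_part_fun f))"

lemma dual_pos_part_apply: "0 \<le> x \<Longrightarrow> dual_apply (dual_pos_part f) x = cone_sup f x"
  using pos_part_fun_diff[of x 0 f]
  by (simp add: dual_pos_part_def dual_of_blinfun_inverse bounded_linear_Blinfun_apply
      bounded_linear_pos_part_fun cone_sup_def)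

instantiation dual :: (banach_lattice) banach_lattice
begin

definition less_eq_dual :: "'a dual \<Rightarrow> 'a dual \<Rightarrow> bool" where
  "less_eq_dual f g \<longleftrightarrow> (\<forall>x\<ge>0. dual_apply f x \<le> dual_apply g x)"

definition less_dual :: "'a dual \<Rightarrow> 'a dual \<Rightarrow> bool" where
  "less_dual f g \<longleftrightarrow> f \<le> g \<and> \<not> g \<le> f"

definition sup_dual :: "'a dual \<Rightarrow> 'a dual \<Rightarrow> 'a dual" where
  "sup_dual f g = f + dual_pos_part (g - f)"

definition inf_dual :: "'a dual \<Rightarrow> 'a dual \<Rightarrow> 'a dual" where
  "inf_dual f g = - sup (- f) (- g)"

definition abs_dual :: "'a dual \<Rightarrow> 'a dual" where
  "abs_dual f = sup f (- f)"

instance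
proof
  fix f g h :: "'a dual" and a b :: real
  show "f < g \<longleftrightarrow> f \<le> g \<and> \<not> g \<le> f" by (rule less_dual_def)
  show "f \<le> f" by (simp add: less_eq_dual_def)
  show "f \<le> h" if "f \<le> g" "g \<le> h"
    using that unfolding less_eq_dual_def by (meson order_trans)
  show "f = g" if "f \<le> g" "g \<le> f"
  proof (rule dual_eqI)
    fix x
    have *: "dual_apply f z = dual_apply g z" if "0 \<le> z" for z
      using \<open>f \<le> g\<close> \<open>g \<le> f\<close> that by (simp add: less_eq_dual_def order.antisym)
    have "dual_apply f (pprt x - pprt (- x)) = dual_apply g (pprt x - pprt (- x))"
      unfolding blinfun.diff_right by (simp add: *)
    then show "dual_apply f x = dual_apply g x"
      by (simp only: pprt_diff_pprt_minus)
  qed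
  show "h + f \<le> h + g" if "f \<le> g"
    using that by (simp add: less_eq_dual_def)
  show "a *\<^sub>R f \<le> a *\<^sub>R g" if "f \<le> g" "0 \<le> a"
    using that by (simp add: less_eq_dual_def mult_left_mono)
  show "a *\<^sub>R f \<le> b *\<^sub>R f" if "a \<le> b" "0 \<le> f"
    using that by (simp add: less_eq_dual_def mult_right_mono)
  have sup1: "u \<le> sup u v" for u v :: "'a dual"
    by (simp add: less_eq_dual_def sup_dual_def dual_pos_part_apply cone_sup_nonneg)
  have sup2: "v \<le> sup u v" for u v :: "'a dual"
    unfolding less_eq_dual_def
  proof (intro allI impI)
    fix x :: 'a assume "0 \<le> x"
    then show "dual_apply v x \<le> dual_apply (sup u v) x"
      using cone_sup_upper[of x x "v - u"] by (simp add: sup_dual_def dual_pos_part_apply)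
  qed
  have sup3: "sup u v \<le> w" if "u \<le> w" "v \<le> w" for u v w :: "'a dual"
    unfolding less_eq_dual_def
  proof (intro allI impI)
    fix x :: 'a assume x: "0 \<le> x"
    have "cone_sup (v - u) x \<le> dual_apply w x - dual_apply u x"
    proof (rule cone_sup_least[OF x])
      fix y assume y: "y \<in> {0..x}"
      have "dual_apply (v - u) y \<le> dual_apply (w - u) y"
        using that y by (simp add: less_eq_dual_def)
      moreover have "0 \<le> dual_apply (w - u) (x - y)"
        using that y by (simp add: less_eq_dual_def)
      then have "dual_apply (w - u) y \<le> dual_apply (w - u) x"
        unfolding blinfun.diff_right by simp
      ultimately show "dual_apply (v - u) y \<le> dual_apply w x - dual_apply u x"
        by simp
    qed
    then show "dual_apply (sup u v) x \<le> dual_apply w x"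
      using x by (simp add: sup_dual_def dual_pos_part_apply)
  qed
  have neg: "- u \<le> v" if "- v \<le> u" for u v :: "'a dual"
    unfolding less_eq_dual_def
  proof (intro allI impI)
    fix x :: 'a assume "0 \<le> x"
    then have "dual_apply (- v) x \<le> dual_apply u x"
      using that unfolding less_eq_dual_def by blast
    then show "dual_apply (- u) x \<le> dual_apply v x"
      by simp
  qed
  show "f \<le> sup f g" by (rule sup1)
  show "g \<le> sup f g" by (rule sup2)
  show "sup g h \<le> f" if "g \<le> f" "h \<le> f" using that by (rule sup3)
  show "inf f g \<le> f" unfolding inf_dual_def by (rule neg[OF sup1])
  show "inf f g \<le> g" unfolding inf_dual_def by (rule neg[OF sup2])
  show "f \<le> inf g h" if "f \<le> g" "f \<le> h"
  proof -
    have "- g \<le> - f" "- h \<le> - f"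
      by (rule neg, simp add: that)+
    then have "sup (- g) (- h) \<le> - f"
      by (rule sup3)
    then have "- (- sup (- g) (- h)) \<le> - f"
      by simp
    then have "- (- f) \<le> - sup (- g) (- h)"
      by (rule neg)
    then show ?thesis
      unfolding inf_dual_def minus_minus .
  qed
  show "\<bar>f\<bar> = sup f (- f)" by (rule abs_dual_def)
  show "norm f \<le> norm g" if fg: "\<bar>f\<bar> \<le> \<bar>g\<bar>"
  proof -
    have le: "\<bar>dual_apply f x\<bar> \<le> norm g * norm x" for x
    proof -
      have ax: "pprt x + pprt (- x) = \<bar>x\<bar>"
        by (simp add: pprt_neg abs_prts)
      have f_le: "dual_apply f z \<le> dual_apply \<bar>f\<bar> z \<and> - dual_apply f z \<le> dual_apply \<bar>f\<bar> z"
        if "0 \<le> z" for z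
        using sup1[of f "- f"] sup2[of "- f" f] that
        by (simp add: abs_dual_def less_eq_dual_def)
      have "\<bar>dual_apply f x\<bar> = \<bar>dual_apply f (pprt x) - dual_apply f (pprt (- x))\<bar>"
        by (simp only: pprt_diff_pprt_minus flip: blinfun.diff_right)
      also have "\<dots> \<le> dual_apply \<bar>f\<bar> (pprt x) + dual_apply \<bar>f\<bar> (pprt (- x))"
        using f_le[of "pprt x"] f_le[of "pprt (- x)"] by simp linarith
      also have "\<dots> = dual_apply \<bar>f\<bar> \<bar>x\<bar>"
        by (simp only: ax flip: blinfun.add_right)
      also have "\<dots> \<le> dual_apply \<bar>g\<bar> \<bar>x\<bar>"
        using fg by (simp add: less_eq_dual_def)
      also have "\<dots> = dual_apply g \<bar>x\<bar> + cone_sup (- g - g) \<bar>x\<bar>"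
        by (simp add: abs_dual_def sup_dual_def dual_pos_part_apply)
      also have "\<dots> \<le> norm g * norm x"
      proof -
        have "cone_sup (- g - g) \<bar>x\<bar> \<le> norm g * norm x - dual_apply g \<bar>x\<bar>"
        proof (rule cone_sup_least)
          fix y assume y: "y \<in> {0..\<bar>x\<bar>}"
          then have "\<bar>x\<bar> - y - y \<le> \<bar>x\<bar>" "- (\<bar>x\<bar> - y - y) \<le> \<bar>x\<bar>"
            by (auto simp: algebra_simps add_mono add_increasing2)
          then have "\<bar>\<bar>x\<bar> - y - y\<bar> \<le> \<bar>x\<bar>"
            by (rule abs_leI)
          then have "norm (\<bar>x\<bar> - y - y) \<le> norm x"
            by (rule norm_le_if_abs_le)
          then have "norm g * norm (\<bar>x\<bar> - y - y) \<le> norm g * norm x"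
            by (simp add: mult_left_mono)
          then have "dual_apply g (\<bar>x\<bar> - y - y) \<le> norm g * norm x"
            using abs_dual_apply_le[of g "\<bar>x\<bar> - y - y"] by linarith
          then show "dual_apply (- g - g) y \<le> norm g * norm x - dual_apply g \<bar>x\<bar>"
            unfolding blinfun.diff_right by simp
        qed simp
        then show ?thesis by simp
      qed
      finally show ?thesis .
    qed
    have "norm (blinfun_of_dual f) \<le> norm g"
      using le by (intro norm_blinfun_bound) auto
    then show ?thesis
      by (simp add: norm_dual.rep_eq)
  qed
qed

end


section \<open>Solid sets, disjoint sequences, L-weak compactness\<close>

definition solid :: "'a::banach_lattice set \<Rightarrow> bool" where
  "solid A \<longleftrightarrow> (\<forall>x\<in>A. \<forall>y. \<bar>y\<bar> \<le> \<bar>x\<bar> \<longrightarrow> y \<in> A)"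

definition solid_hull :: "'a::banach_lattice set \<Rightarrow> 'a set" where
  "solid_hull A = {y. \<exists>x\<in>A. \<bar>y\<bar> \<le> \<bar>x\<bar>}"

definition disjoint_seq :: "(nat \<Rightarrow> 'a::banach_lattice) \<Rightarrow> bool" where
  "disjoint_seq x \<longleftrightarrow> (\<forall>n m. n \<noteq> m \<longrightarrow> inf \<bar>x n\<bar> \<bar>x m\<bar> = 0)"

definition L_weakly_compact :: "'a::banach_lattice set \<Rightarrow> bool" where
  "L_weakly_compact A \<longleftrightarrow>
     bounded A \<and> (\<forall>x. disjoint_seq x \<and> range x \<subseteq> solid_hull A \<longrightarrow> x \<longlonglongrightarrow> 0)"


section \<open>Modes of convergence\<close>

definition directed_set :: "'i set \<Rightarrow> ('i \<Rightarrow> 'i \<Rightarrow> bool) \<Rightarrow> bool" where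
  "directed_set I le \<longleftrightarrow>
     I \<noteq> {} \<and> reflp_on I le \<and> transp_on I le \<and> (\<forall>i\<in>I. \<forall>j\<in>I. \<exists>k\<in>I. le i k \<and> le j k)"

text \<open>
  \<open>decreasing_net_0 I le y\<close> says that \<open>y\<close> is a net indexed by \<open>I\<close>, directed by \<open>le\<close>, with
  \<open>y \<down> 0\<close>: it is decreasing and its infimum is \<open>0\<close>.
\<close>

definition decreasing_net_0 ::
  "'i set \<Rightarrow> ('i \<Rightarrow> 'i \<Rightarrow> bool) \<Rightarrow> ('i \<Rightarrow> 'a::banach_lattice) \<Rightarrow> bool" where
  "decreasing_net_0 I le y \<longleftrightarrow>
     directed_set I le \<and> (\<forall>i\<in>I. \<forall>j\<in>I. le i j \<longrightarrow> y j \<le> y i) \<and>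
     (\<forall>i\<in>I. 0 \<le> y i) \<and> (\<forall>z. (\<forall>i\<in>I. z \<le> y i) \<longrightarrow> z \<le> 0)"

text \<open>
  HOL cannot quantify over the type of the indices inside a definition. Index sets contained in
  \<^typ>\<open>'a\<close> are enough: a decreasing net may be replaced by its range, directed by \<open>\<ge>\<close>. The
  lemmas \<open>order_convergentI\<close> and \<open>order_continuous_normD\<close> below confirm that the two
  definitions do not depend on the choice of the index type.

  The net whose convergence is asserted is given by a filter, as usual in the library; for
  sequences the filter is \<^term>\<open>sequentially\<close>.
\<close>

definition order_convergent :: "('i \<Rightarrow> 'a::banach_lattice) \<Rightarrow> 'a \<Rightarrow> 'i filter \<Rightarrow> bool" where
  "order_convergent x l F \<longleftrightarrow>
     (\<exists>(I :: 'a set) le y. decreasing_net_0 I le y \<and> (\<forall>i\<in>I. \<forall>\<^sub>F n in F. \<bar>x n - l\<bar> \<le> y i))"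

definition order_continuous_norm :: "'a::banach_lattice itself \<Rightarrow> bool" where
  "order_continuous_norm _ \<longleftrightarrow>
     (\<forall>(I :: 'a set) le (y :: 'a \<Rightarrow> 'a). decreasing_net_0 I le y \<longrightarrow>
        (\<forall>e>0. \<exists>i\<in>I. \<forall>j\<in>I. le i j \<longrightarrow> norm (y j) < e))"

lemma decreasing_net_0_range:
  fixes y :: "'i \<Rightarrow> 'a::banach_lattice"
  assumes "decreasing_net_0 I le y"
  shows "decreasing_net_0 (y ` I) (\<lambda>a b. b \<le> a) (\<lambda>a. a)"
proof -
  have dir: "directed_set I le"
    and mono: "\<And>i j. i \<in> I \<Longrightarrow> j \<in> I \<Longrightarrow> le i j \<Longrightarrow> y j \<le> y i"
    and nonneg: "\<And>i. i \<in> I \<Longrightarrow> 0 \<le> y i"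
    and glb: "\<forall>z. (\<forall>i\<in>I. z \<le> y i) \<longrightarrow> z \<le> 0"
    using assms unfolding decreasing_net_0_def by blast+
  have "\<exists>k\<in>I. y k \<le> y i \<and> y k \<le> y j" if ij: "i \<in> I" "j \<in> I" for i j
  proof -
    obtain k where "k \<in> I" "le i k" "le j k"
      using dir ij unfolding directed_set_def by blast
    then show ?thesis
      using mono ij by (intro bexI[of _ k] conjI) simp_all
  qed
  moreover have "I \<noteq> {}"
    using dir by (simp add: directed_set_def)
  ultimately have "directed_set (y ` I) (\<lambda>a b. b \<le> a)"
    by (auto simp: directed_set_def reflp_on_def transp_on_def intro: order_trans)
  then show ?thesis
    unfolding decreasing_net_0_def using nonneg glb by auto
qed

lemma order_convergentI:
  fixes y :: "'j \<Rightarrow> 'a::banach_lattice"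
  assumes "decreasing_net_0 I le y" "\<And>i. i \<in> I \<Longrightarrow> \<forall>\<^sub>F n in F. \<bar>x n - l\<bar> \<le> y i"
  shows "order_convergent x l F"
  unfolding order_convergent_def
  using assms(2)
  by (intro exI[of _ "y ` I"] exI[of _ "\<lambda>a b. b \<le> a"] exI[of _ "\<lambda>a. a"] conjI
      decreasing_net_0_range[OF assms(1)]) auto

lemma order_continuous_normD:
  fixes y :: "'i \<Rightarrow> 'a::banach_lattice"
  assumes "order_continuous_norm TYPE('a)" "decreasing_net_0 I le y" "0 < e"
  shows "\<exists>i\<in>I. \<forall>j\<in>I. le i j \<longrightarrow> norm (y j) < e"
proof -
  have "\<exists>a\<in>y ` I. \<forall>b\<in>y ` I. b \<le> a \<longrightarrow> norm b < e"
    using assms(1)[unfolded order_continuous_norm_def, rule_format,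
        OF decreasing_net_0_range[OF assms(2)] assms(3)] .
  then obtain i where i: "i \<in> I" "\<forall>b\<in>y ` I. b \<le> y i \<longrightarrow> norm b < e"
    unfolding bex_simps by (rule bexE)
  have "norm (y j) < e" if "j \<in> I" "le i j" for j
  proof -
    have "y j \<le> y i"
      using assms(2) i(1) that unfolding decreasing_net_0_def by blast
    with i(2) that(1) show ?thesis
      by blast
  qed
  with i(1) show ?thesis
    by blast
qed

definition weakly_convergent :: "('i \<Rightarrow> 'a::banach_lattice) \<Rightarrow> 'a \<Rightarrow> 'i filter \<Rightarrow> bool" where
  "weakly_convergent x l F \<longleftrightarrow>
     (\<forall>f :: 'a dual. ((\<lambda>n. dual_apply f (x n)) \<longlongrightarrow> dual_apply f l) F)"

definition weak_star_convergent ::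
  "('i \<Rightarrow> 'a::banach_lattice dual) \<Rightarrow> 'a dual \<Rightarrow> 'i filter \<Rightarrow> bool" where
  "weak_star_convergent f l F \<longleftrightarrow> (\<forall>x. ((\<lambda>n. dual_apply (f n) x) \<longlongrightarrow> dual_apply l x) F)"

definition uo_convergent :: "('i \<Rightarrow> 'a::banach_lattice) \<Rightarrow> 'a \<Rightarrow> 'i filter \<Rightarrow> bool" where
  "uo_convergent x l F \<longleftrightarrow> (\<forall>u\<ge>0. order_convergent (\<lambda>n. inf \<bar>x n - l\<bar> u) 0 F)"

definition uaw_convergent :: "('i \<Rightarrow> 'a::banach_lattice) \<Rightarrow> 'a \<Rightarrow> 'i filter \<Rightarrow> bool" where
  "uaw_convergent x l F \<longleftrightarrow> (\<forall>u\<ge>0. weakly_convergent (\<lambda>n. inf \<bar>x n - l\<bar> u) 0 F)"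

definition uaw_star_convergent ::
  "('i \<Rightarrow> 'a::banach_lattice dual) \<Rightarrow> 'a dual \<Rightarrow> 'i filter \<Rightarrow> bool" where
  "uaw_star_convergent f l F \<longleftrightarrow> (\<forall>u\<ge>0. weak_star_convergent (\<lambda>n. inf \<bar>f n - l\<bar> u) 0 F)"

abbreviation uo_null :: "(nat \<Rightarrow> 'a::banach_lattice) \<Rightarrow> bool" where
  "uo_null x \<equiv> uo_convergent x 0 sequentially"

abbreviation uaw_null :: "(nat \<Rightarrow> 'a::banach_lattice) \<Rightarrow> bool" where
  "uaw_null x \<equiv> uaw_convergent x 0 sequentially"

abbreviation uaw_star_null :: "(nat \<Rightarrow> 'a::banach_lattice dual) \<Rightarrow> bool" where
  "uaw_star_null f \<equiv> uaw_star_convergent f 0 sequentially"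

end

theory Submission
  imports Defs
begin

text \<open>
  If a solid set is L-weakly compact, positive disjoint sequences in it are norm null, which gives
  one direction of every equivalence. For the converses it is enough to test against disjoint
  sequences: they are \<open>uaw\<close>-null, and in a dual also \<open>uaw*\<close>- and \<open>uo\<close>-null, because finite sums of
  disjoint elements of \<open>{0..u}\<close> stay below \<open>u\<close>.

  In (1), take norming positive functionals of a disjoint sequence \<open>x\<close> and restrict the \<open>n\<close>-th one
  to the ideal generated by \<open>x n\<close>; the resulting functionals are disjoint and still norming.

  In (2), let \<open>f\<close> be a positive disjoint sequence of functionals, bounded but not norm null. If it
  is weak* null, almost norming elements of a sparse subsequence can be made disjoint by subtracting
  large multiples of the earlier ones and small multiples of all of them. Otherwise \<open>f n u\<close> does
  not tend to \<open>0\<close> for some \<open>u\<close>, and disjoint elements are chosen one after the other inside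
  \<open>{0..u}\<close>.
\<close>

section \<open>Sublinear functionals and the Hahn--Banach theorem\<close>

text \<open>Homogeneity is asked for only as an inequality and for positive factors; applying it to
  \<open>inverse r\<close> gives equality, and the factor \<open>2\<close> at \<open>0\<close> gives
  \<open>p 0 = 0\<close>.\<close>

definition sublinear :: "('a::real_vector \<Rightarrow> real) \<Rightarrow> bool" where
  "sublinear p \<longleftrightarrow> (\<forall>x y. p (x + y) \<le> p x + p y) \<and> (\<forall>r>0. \<forall>x. p (r *\<^sub>R x) \<le> r * p x)"

lemma sublinear_add: "sublinear p \<Longrightarrow> p (x + y) \<le> p x + p y"
  by (simp add: sublinear_def)

lemma sublinear_scaleR:
  assumes "sublinear p" "0 < r"
  shows "p (r *\<^sub>R x) = r * p x"
proof (rule order.antisym)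
  show "p (r *\<^sub>R x) \<le> r * p x"
    using assms by (simp add: sublinear_def)
  have "p (inverse r *\<^sub>R (r *\<^sub>R x)) \<le> inverse r * p (r *\<^sub>R x)"
    using assms unfolding sublinear_def by (metis inverse_positive_iff_positive)
  then show "r * p x \<le> p (r *\<^sub>R x)"
    using \<open>0 < r\<close> by (simp add: field_simps)
qed

lemma sublinear_zero: "sublinear p \<Longrightarrow> p 0 = 0"
  using sublinear_scaleR[of p 2 0] by simp

lemma sublinear_neg: "sublinear p \<Longrightarrow> - p (- x) \<le> p x"
  using sublinear_add[of p x "- x"] by (simp add: sublinear_zero)

text \<open>Zorn's lemma for the reversed pointwise order: the pointwise infimum of a chain of
  sublinear minorants is again sublinear.\<close>

lemma sublinear_minimal:
  assumes p: "sublinear p"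
  obtains q where "sublinear q" "\<And>x. q x \<le> p x"
    "\<And>q'. sublinear q' \<Longrightarrow> (\<And>x. q' x \<le> q x) \<Longrightarrow> q' = q"
proof -
  define A where "A = {q. sublinear q \<and> (\<forall>x. q x \<le> p x)}"
  define P where "P = (\<lambda>a b :: 'a \<Rightarrow> real. \<forall>x. b x \<le> a x)"
  have "\<exists>m\<in>A. \<forall>a\<in>A. P m a \<longrightarrow> a = m"
  proof (rule predicate_Zorn)
    show "partial_order_on A (relation_of P A)"
      by (rule partial_order_on_relation_ofI) (auto simp: P_def fun_eq_iff intro: order_trans order.antisym)
    fix C assume C: "C \<in> Chains (relation_of P A)"
    then have CA: "q \<in> A" if "q \<in> C" for q
      using that by (auto simp: Chains_def relation_of_def)
    have chain: "P a b \<or> P b a" if "a \<in> C" "b \<in> C" for a b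
      using C that by (auto simp: Chains_def relation_of_def)
    show "\<exists>u\<in>A. \<forall>a\<in>C. P a u"
    proof (cases "C = {}")
      case True
      then show ?thesis using p by (auto simp: A_def)
    next
      case False
      define u where "u x = (INF q\<in>C. q x)" for x
      \<comment> \<open>The bound \<open>- p (- x)\<close> is the same for all \<open>q\<close> in
        the chain, so the infimum \<open>u x\<close> is finite.\<close>
      have bdd: "bdd_below ((\<lambda>q. q x) ` C)" for x
      proof (rule bdd_belowI2)
        fix q assume "q \<in> C"
        then have "sublinear q" "q (- x) \<le> p (- x)"
          using CA by (auto simp: A_def)
        then show "- p (- x) \<le> q x"
          using sublinear_neg[of q x] by linarith
      qed
      have lower: "u x \<le> q x" if "q \<in> C" for q x
        unfolding u_def by (rule cINF_lower[OF bdd that])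
      have greatest: "c \<le> u x" if "\<And>q. q \<in> C \<Longrightarrow> c \<le> q x" for c x
        unfolding u_def by (rule cINF_greatest[OF False that])
      have "u (x + y) \<le> u x + u y" for x y
      proof -
        have "u (x + y) \<le> q1 x + q2 y" if q12: "q1 \<in> C" "q2 \<in> C" for q1 q2
        proof -
          \<comment> \<open>The smaller of \<open>q1\<close> and \<open>q2\<close>: the chain
            property is what makes the infimum subadditive.\<close>
          obtain q where q: "q \<in> C" "q x \<le> q1 x" "q y \<le> q2 y"
            using chain[OF q12] q12 unfolding P_def by blast
          have "u (x + y) \<le> q (x + y)"
            by (rule lower[OF q(1)])
          also have "\<dots> \<le> q x + q y"
            using CA[OF q(1)] by (simp add: A_def sublinear_add)
          finally show ?thesis using q by linarith
        qed
        then have "u (x + y) - q1 x \<le> u y" if "q1 \<in> C" for q1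
          using that by (intro greatest) (smt (verit))
        then have "u (x + y) - u y \<le> u x"
          by (intro greatest) (simp add: algebra_simps)
        then show ?thesis by simp
      qed
      moreover have "u (r *\<^sub>R x) \<le> r * u x" if "0 < r" for r x
      proof -
        have "u (r *\<^sub>R x) / r \<le> u x"
        proof (rule greatest)
          fix q assume q: "q \<in> C"
          then have "q (r *\<^sub>R x) = r * q x"
            using CA that by (intro sublinear_scaleR) (auto simp: A_def)
          then show "u (r *\<^sub>R x) / r \<le> q x"
            using lower[OF q, of "r *\<^sub>R x"] that by (simp add: field_simps)
        qed
        then show ?thesis using that by (simp add: field_simps)
      qed
      ultimately have "sublinear u"
        by (simp add: sublinear_def)
      moreover have "u x \<le> p x" for x
      proof -
        obtain q where "q \<in> C" using False by blast
        then show ?thesis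
          using lower[of q x] CA[of q] unfolding A_def by (auto intro: order_trans)
      qed
      ultimately show ?thesis
        by (auto simp: A_def P_def intro: lower)
    qed
  qed
  then obtain q where q: "q \<in> A" "\<And>a. a \<in> A \<Longrightarrow> P q a \<Longrightarrow> a = q"
    by blast
  show thesis
  proof (rule that)
    show "sublinear q" "q x \<le> p x" for x
      using q(1) by (auto simp: A_def)
    fix q' assume q': "sublinear q'" "\<And>x. q' x \<le> q x"
    moreover have "q' x \<le> p x" for x
      using q'(2)[of x] q(1) unfolding A_def by (auto intro: order_trans)
    ultimately show "q' = q"
      by (intro q(2)) (auto simp: A_def P_def)
  qed
qed

text \<open>For sublinear \<open>p\<close>, this is the largest sublinear minorant of
  \<open>p\<close> whose value at \<open>- y\<close> is at most \<open>- p y\<close>.\<close>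

definition lower_at :: "('a::real_vector \<Rightarrow> real) \<Rightarrow> 'a \<Rightarrow> 'a \<Rightarrow> real" where
  "lower_at p y x = (INF t\<in>{0..}. p (x + t *\<^sub>R y) - t * p y)"

lemma sublinear_scaleR_nonneg:
  assumes "sublinear p" "0 \<le> r"
  shows "p (r *\<^sub>R x) = r * p x"
  using assms by (cases "r = 0") (auto simp: sublinear_zero sublinear_scaleR)

text \<open>Subadditivity comes from adding the parameters of two competitors, homogeneity from
  replacing \<open>t\<close> by \<open>r * t\<close>; the infimum is bounded below by
  \<open>- p (- x)\<close>.\<close>

lemma
  assumes p: "sublinear p"
  shows lower_at_le: "0 \<le> t \<Longrightarrow> lower_at p y x \<le> p (x + t *\<^sub>R y) - t * p y"
    and sublinear_lower_at: "sublinear (lower_at p y)"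
proof -
  have bdd: "bdd_below ((\<lambda>t. p (x + t *\<^sub>R y) - t * p y) ` {0..})" for x
  proof (rule bdd_belowI2)
    fix t :: real assume "t \<in> {0..}"
    then have "t * p y = p ((x + t *\<^sub>R y) + - x)"
      using p by (simp add: sublinear_scaleR_nonneg)
    also have "\<dots> \<le> p (x + t *\<^sub>R y) + p (- x)"
      by (rule sublinear_add[OF p])
    finally show "- p (- x) \<le> p (x + t *\<^sub>R y) - t * p y" by simp
  qed
  show lower: "lower_at p y x \<le> p (x + t *\<^sub>R y) - t * p y" if "0 \<le> t" for t x
    unfolding lower_at_def using that by (intro cINF_lower[OF bdd]) auto
  have greatest: "c \<le> lower_at p y x" if "\<And>t. 0 \<le> t \<Longrightarrow> c \<le> p (x + t *\<^sub>R y) - t * p y" for c x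
    unfolding lower_at_def using that by (intro cINF_greatest) auto
  have "lower_at p y (x + z) \<le> lower_at p y x + lower_at p y z" for x z
  proof -
    have "lower_at p y (x + z) \<le> (p (x + s *\<^sub>R y) - s * p y) + (p (z + t *\<^sub>R y) - t * p y)"
      if "0 \<le> s" "0 \<le> t" for s t
    proof -
      have "lower_at p y (x + z) \<le> p ((x + z) + (s + t) *\<^sub>R y) - (s + t) * p y"
        using that by (intro lower) simp
      moreover have "p ((x + z) + (s + t) *\<^sub>R y) \<le> p (x + s *\<^sub>R y) + p (z + t *\<^sub>R y)"
        using sublinear_add[OF p, of "x + s *\<^sub>R y" "z + t *\<^sub>R y"] by (simp add: algebra_simps)
      ultimately show ?thesis by (simp add: algebra_simps)
    qed
    then have "lower_at p y (x + z) - (p (x + s *\<^sub>R y) - s * p y) \<le> lower_at p y z"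
      if "0 \<le> s" for s
      using that by (intro greatest) (smt (verit))
    then have "lower_at p y (x + z) - lower_at p y z \<le> lower_at p y x"
      by (intro greatest) (simp add: algebra_simps)
    then show ?thesis by simp
  qed
  moreover have "lower_at p y (r *\<^sub>R x) \<le> r * lower_at p y x" if "0 < r" for r x
  proof -
    have "lower_at p y (r *\<^sub>R x) / r \<le> lower_at p y x"
    proof (rule greatest)
      fix t :: real assume "0 \<le> t"
      then have "lower_at p y (r *\<^sub>R x) \<le> p (r *\<^sub>R x + (r * t) *\<^sub>R y) - (r * t) * p y"
        using that by (intro lower) simp
      also have "\<dots> = p (r *\<^sub>R (x + t *\<^sub>R y)) - r * t * p y"
        by (simp add: algebra_simps)
      also have "\<dots> = r * (p (x + t *\<^sub>R y) - t * p y)"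
        using that p by (simp only: sublinear_scaleR) (simp add: algebra_simps)
      finally show "lower_at p y (r *\<^sub>R x) / r \<le> p (x + t *\<^sub>R y) - t * p y"
        using that by (simp add: field_simps)
    qed
    then show ?thesis using that by (simp add: field_simps)
  qed
  ultimately show "sublinear (lower_at p y)"
    by (simp add: sublinear_def)
qed

lemma lower_at_le_self: "sublinear p \<Longrightarrow> lower_at p y x \<le> p x"
  using lower_at_le[of p 0 y x] by simp

lemma lower_at_minus: "sublinear p \<Longrightarrow> lower_at p y (- y) \<le> - p y"
  using lower_at_le[of p 1 y "- y"] by (simp add: sublinear_zero)

text \<open>A minimal sublinear \<open>q\<close> coincides with \<open>lower_at q y\<close> for
  every \<open>y\<close>, hence \<open>q (- y) = - q y\<close>, and an odd sublinear functional is
  linear.\<close>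

theorem sublinear_hahn_banach:
  assumes p: "sublinear p"
  obtains f where "linear f" "\<And>x. f x \<le> p x" "f x0 = p x0"
proof -
  \<comment> \<open>Minimising below \<open>lower_at p x0\<close> instead of \<open>p\<close> forces
    \<open>q (- x0) \<le> - p x0\<close>, which yields the value \<open>p x0\<close> at
    \<open>x0\<close>.\<close>
  obtain q where q: "sublinear q" "\<And>x. q x \<le> lower_at p x0 x"
    and minimal: "\<And>q'. sublinear q' \<Longrightarrow> (\<And>x. q' x \<le> q x) \<Longrightarrow> q' = q"
    using sublinear_minimal[OF sublinear_lower_at[OF p]] by metis
  have le_p: "q x \<le> p x" for x
    using q(2)[of x] lower_at_le_self[OF p, of x0 x] by simp
  have "lower_at q y = q" for y
    using q(1) by (intro minimal sublinear_lower_at lower_at_le_self)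
  then have minus: "q (- y) = - q y" for y
    using lower_at_minus[OF q(1), of y] sublinear_neg[OF q(1), of y] by simp
  have "q (x + y) = q x + q y" for x y
    using sublinear_add[OF q(1), of x y] sublinear_add[OF q(1), of "x + y" "- y"] minus[of y]
    by simp
  moreover have "q (r *\<^sub>R x) = r *\<^sub>R q x" for r x
  proof (cases "0 \<le> r")
    case False
    then have "q ((- r) *\<^sub>R x) = - r * q x"
      by (intro sublinear_scaleR_nonneg q(1)) simp
    then show ?thesis by (simp add: minus)
  qed (simp add: sublinear_scaleR_nonneg[OF q(1)])
  ultimately have "linear q"
    by (intro linearI)
  moreover have "p x0 \<le> q x0"
    using q(2)[of "- x0"] lower_at_minus[OF p, of x0] minus[of x0] by simp
  ultimately show thesis
    using le_p le_p[of x0] by (intro that) (auto intro: order.antisym)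
qed

lemma pprt_scaleR: "0 \<le> r \<Longrightarrow> pprt (r *\<^sub>R x) \<le> r *\<^sub>R pprt x" for x :: "'a::banach_lattice"
  by (simp add: pprt_def scaleR_left_mono scaleR_nonneg_nonneg)

text \<open>A functional dominated by \<open>\<lambda>x. norm (pprt x)\<close> is positive and of norm at most one.\<close>

lemma norming_positive_functional:
  fixes x :: "'a::banach_lattice"
  assumes "0 \<le> x"
  obtains f :: "'a dual" where "0 \<le> f" "norm f \<le> 1" "dual_apply f x = norm x"
proof -
  have pprt_add: "pprt (a + b) \<le> pprt a + pprt b" for a b :: 'a
    by (simp add: pprt_def add_mono add_nonneg_nonneg)
  have "sublinear (\<lambda>a :: 'a. norm (pprt a))"
    unfolding sublinear_def
  proof (intro conjI allI impI)
    show "norm (pprt (a + b)) \<le> norm (pprt a) + norm (pprt b)" for a b :: 'a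
      using norm_mono_pos[OF zero_le_pprt pprt_add[of a b]] norm_triangle_ineq[of "pprt a" "pprt b"]
      by linarith
    show "norm (pprt (r *\<^sub>R a)) \<le> r * norm (pprt a)" if "0 < r" for r and a :: 'a
      using norm_mono_pos[OF zero_le_pprt pprt_scaleR[OF less_imp_le[OF that], of a]] that by simp
  qed
  then obtain f where f: "linear f" "\<And>a. f a \<le> norm (pprt a)" "f x = norm (pprt x)"
    using sublinear_hahn_banach by blast
  have "\<bar>f a\<bar> \<le> norm a" for a
    using f(2)[of a] f(2)[of "- a"] norm_pprt_le[of a] norm_pprt_le[of "- a"] linear_neg[OF f(1), of a]
    by (simp add: abs_le_iff)
  then have bl: "bounded_linear f"
    using f(1) by (intro bounded_linear_intro[where K=1]) (auto simp: linear_add linear_scale)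
  define g where "g = dual_of_blinfun (Blinfun f)"
  have g: "dual_apply g a = f a" for a
    by (simp add: g_def dual_of_blinfun_inverse bounded_linear_Blinfun_apply[OF bl])
  show thesis
  proof (rule that)
    show "0 \<le> g"
      unfolding less_eq_dual_def
    proof (intro allI impI)
      fix a :: 'a assume "0 \<le> a"
      then show "dual_apply 0 a \<le> dual_apply g a"
        using f(2)[of "- a"] linear_neg[OF f(1), of a] by (simp add: g)
    qed
    show "norm g \<le> 1"
      unfolding norm_dual.rep_eq using \<open>\<And>a. \<bar>f a\<bar> \<le> norm a\<close>
      by (intro norm_blinfun_bound) (auto simp: g)
    show "dual_apply g x = norm x"
      using f(3) assms by (simp add: g)
  qed
qed

section \<open>Disjoint sequences\<close>

lemma dual_apply_nonneg: "0 \<le> f \<Longrightarrow> 0 \<le> x \<Longrightarrow> 0 \<le> dual_apply f x"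
  for f :: "'a::banach_lattice dual"
  by (auto simp: less_eq_dual_def)

lemma dual_apply_mono: "0 \<le> f \<Longrightarrow> x \<le> y \<Longrightarrow> dual_apply f x \<le> dual_apply f y"
  for f :: "'a::banach_lattice dual"
  using dual_apply_nonneg[of f "y - x"] by (simp add: blinfun.diff_right)

lemma dual_apply_leD: "f \<le> g \<Longrightarrow> 0 \<le> x \<Longrightarrow> dual_apply f x \<le> dual_apply g x"
  for f :: "'a::banach_lattice dual"
  by (auto simp: less_eq_dual_def)

lemma dual_apply_prts: "dual_apply f x = dual_apply f (pprt x) - dual_apply f (pprt (- x))"
  for f :: "'a::banach_lattice dual"
  by (simp only: pprt_diff_pprt_minus flip: blinfun.diff_right)

lemma abs_dual_apply_le_abs:
  fixes f :: "'a::banach_lattice dual"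
  assumes "0 \<le> f"
  shows "\<bar>dual_apply f x\<bar> \<le> dual_apply f \<bar>x\<bar>"
  using dual_apply_mono[OF assms abs_ge_self[of x]] dual_apply_mono[OF assms abs_ge_minus_self[of x]]
  by (simp add: abs_le_iff blinfun.minus_right)

lemma inf_dual_apply:
  fixes f g :: "'a::banach_lattice dual"
  assumes "0 \<le> u"
  shows "dual_apply (inf f g) u = dual_apply f u - cone_sup (f - g) u"
  using assms by (simp add: inf_dual_def sup_dual_def dual_pos_part_apply)

text \<open>Together with \<open>inf_dual_approx\<close> this is the Riesz-Kantorovich formula:
  \<open>inf f g\<close> at \<open>u\<close> is the infimum of
  \<open>dual_apply f (u - v) + dual_apply g v\<close> over
  \<open>0 \<le> v \<le> u\<close>.\<close>

lemma inf_dual_apply_le: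
  fixes f g :: "'a::banach_lattice dual"
  assumes "0 \<le> v" "v \<le> u"
  shows "dual_apply (inf f g) u \<le> dual_apply f (u - v) + dual_apply g v"
  using assms cone_sup_upper[of v u "f - g"] inf_dual_apply[of u f g]
  by (simp add: blinfun.diff_right)

lemma inf_dual_approx:
  fixes f g :: "'a::banach_lattice dual"
  assumes "0 \<le> u" "dual_apply (inf f g) u < c"
  obtains v where "0 \<le> v" "v \<le> u" "dual_apply f (u - v) + dual_apply g v < c"
proof -
  have "\<exists>v\<in>{0..u}. dual_apply f u - c < dual_apply (f - g) v"
  proof (rule ccontr)
    assume "\<not> ?thesis"
    then have "cone_sup (f - g) u \<le> dual_apply f u - c"
      by (intro cone_sup_least assms) (auto simp: not_less)
    then show False
      using assms inf_dual_apply[of u f g] by simp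
  qed
  then obtain v where "0 \<le> v" "v \<le> u" "dual_apply f u - c < dual_apply (f - g) v"
    by auto
  then show thesis
    by (intro that[of v]) (simp_all add: blinfun.diff_right)
qed

text \<open>With \<open>t = inf x (y + z)\<close>, the difference \<open>t - inf x y\<close> is the
  supremum of \<open>t - x\<close> and \<open>t - y\<close>, and each of these is below
  \<open>inf x z\<close>.\<close>

lemma inf_add_le:
  fixes x y z :: "'a::banach_lattice"
  assumes "0 \<le> x" "0 \<le> y" "0 \<le> z"
  shows "inf x (y + z) \<le> inf x y + inf x z"
proof -
  define t where "t = inf x (y + z)"
  have t: "t \<le> x" "t \<le> y + z"
    by (simp_all add: t_def)
  have "t - x \<le> 0" "t - y \<le> z"
    using t by (simp_all add: algebra_simps)
  moreover have "t - y \<le> x"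
    using t(1) assms(2) by (simp add: algebra_simps add_increasing2)
  moreover have "0 \<le> inf x z"
    using assms by simp
  ultimately have "t - x \<le> inf x z" "t - y \<le> inf x z"
    by (auto intro: order_trans[of _ 0])
  then have "sup (t - x) (t - y) \<le> inf x z"
    by (rule sup_least)
  moreover have "t - inf x y = sup (t - x) (t - y)"
    by (simp add: diff_inf_eq_sup add_sup_distrib_left)
  ultimately have "t - inf x y \<le> inf x z"
    by simp
  then show ?thesis
    unfolding diff_le_eq t_def by (simp only: add.commute)
qed

lemma inf_sum_eq_0:
  fixes a :: "'i \<Rightarrow> 'a::banach_lattice"
  assumes "finite F" "0 \<le> b" "\<And>i. i \<in> F \<Longrightarrow> 0 \<le> a i" "\<And>i. i \<in> F \<Longrightarrow> inf b (a i) = 0"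
  shows "inf b (sum a F) = 0"
  using assms
proof (induction F)
  case (insert i F)
  have "inf b (a i + sum a F) \<le> inf b (a i) + inf b (sum a F)"
    using insert by (intro inf_add_le sum_nonneg) auto
  also have "\<dots> = 0"
    using insert by simp
  finally show ?case
    using insert by (intro order.antisym) (auto intro: sum_nonneg add_nonneg_nonneg)
qed (simp add: inf_absorb2)

text \<open>Disjointness turns sums into suprema, by \<open>a + b = inf a b + sup a b\<close>, and
  suprema keep a common upper bound.\<close>

lemma sum_disjoint_le:
  fixes a :: "'i \<Rightarrow> 'a::banach_lattice"
  assumes "finite F" "0 \<le> u" "\<And>i. i \<in> F \<Longrightarrow> 0 \<le> a i" "\<And>i. i \<in> F \<Longrightarrow> a i \<le> u"
    "\<And>i j. i \<in> F \<Longrightarrow> j \<in> F \<Longrightarrow> i \<noteq> j \<Longrightarrow> inf (a i) (a j) = 0"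
  shows "sum a F \<le> u"
  using assms
proof (induction F)
  case (insert i F)
  have "inf (a i) (sum a F) = 0"
    using insert by (intro inf_sum_eq_0) auto
  then have "a i + sum a F = sup (a i) (sum a F)"
    using add_eq_inf_sup[of "a i" "sum a F"] by simp
  also have "\<dots> \<le> u"
    using insert by (intro sup_least) auto
  finally show ?case
    using insert by simp
qed simp

section \<open>Elementary stability of disjointness\<close>

lemma inf_eq_0_mono:
  fixes a b c d :: "'a::banach_lattice"
  assumes "inf c d = 0" "0 \<le> a" "a \<le> c" "0 \<le> b" "b \<le> d"
  shows "inf a b = 0"
  using assms inf_mono[of a c b d] by (intro order.antisym) auto

lemma disjoint_seq_nonnegI:
  fixes x :: "nat \<Rightarrow> 'a::banach_lattice"
  assumes "\<And>n. 0 \<le> x n" "\<And>m n. m < n \<Longrightarrow> inf (x m) (x n) = 0"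
  shows "disjoint_seq x"
  unfolding disjoint_seq_def
proof (intro allI impI)
  fix n m :: nat assume "n \<noteq> m"
  then consider "n < m" | "m < n"
    by linarith
  then have "inf (x n) (x m) = 0"
  proof cases
    case 1
    then show ?thesis by (rule assms(2))
  next
    case 2
    then show ?thesis using assms(2)[OF 2] by (simp only: inf.commute)
  qed
  then show "inf \<bar>x n\<bar> \<bar>x m\<bar> = 0"
    by (simp only: abs_of_nonneg[OF assms(1)])
qed

lemma disjoint_seq_abs: "disjoint_seq x \<Longrightarrow> disjoint_seq (\<lambda>n. \<bar>x n\<bar>)"
  by (simp add: disjoint_seq_def)

lemma disjoint_seq_subseq: "disjoint_seq x \<Longrightarrow> strict_mono r \<Longrightarrow> disjoint_seq (x \<circ> r)"
  by (simp add: disjoint_seq_def strict_mono_eq)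

text \<open>Truncation by \<open>u\<close> preserves disjointness, so one order bound serves all
  partial sums. The null statements for disjoint sequences rest on this bound.\<close>

lemma disjoint_seq_sum_inf_le:
  assumes "disjoint_seq x" "0 \<le> u"
  shows "(\<Sum>n<N. inf \<bar>x n\<bar> u) \<le> u"
proof (rule sum_disjoint_le)
  fix i j :: nat assume "i \<noteq> j"
  then have "inf \<bar>x i\<bar> \<bar>x j\<bar> = 0"
    using assms by (simp add: disjoint_seq_def)
  then show "inf (inf \<bar>x i\<bar> u) (inf \<bar>x j\<bar> u) = 0"
    by (rule inf_eq_0_mono) (use assms in auto)
qed (use assms in auto)

section \<open>Disjoint sequences are null in the unbounded modes of convergence\<close>

lemma summable_dual_apply_disjoint:
  fixes g :: "'a::banach_lattice dual"
  assumes "disjoint_seq x" "0 \<le> u" "0 \<le> g"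
  shows "summable (\<lambda>n. dual_apply g (inf \<bar>x n\<bar> u))"
proof (rule summableI_nonneg_bounded)
  show "(\<Sum>n<N. dual_apply g (inf \<bar>x n\<bar> u)) \<le> dual_apply g u" for N
    using dual_apply_mono[OF assms(3) disjoint_seq_sum_inf_le[OF assms(1,2)]]
    by (simp add: blinfun.sum_right)
qed (use assms in \<open>auto intro: dual_apply_nonneg\<close>)

lemma summable_disjoint_dual_apply:
  fixes f :: "nat \<Rightarrow> 'a::banach_lattice dual"
  assumes "disjoint_seq f" "0 \<le> u" "0 \<le> x"
  shows "summable (\<lambda>n. dual_apply (inf \<bar>f n\<bar> u) x)"
    and "(\<Sum>n. dual_apply (inf \<bar>f n\<bar> u) x) \<le> dual_apply u x"
proof -
  have sum: "dual_apply (sum h F) x = (\<Sum>n\<in>F. dual_apply (h n) x)"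
    for h :: "nat \<Rightarrow> 'a dual" and F
    by (induction F rule: infinite_finite_induct) auto
  have le: "(\<Sum>n<N. dual_apply (inf \<bar>f n\<bar> u) x) \<le> dual_apply u x" for N
    using dual_apply_leD[OF disjoint_seq_sum_inf_le[OF assms(1,2)] assms(3)]
    by (simp add: sum)
  show "summable (\<lambda>n. dual_apply (inf \<bar>f n\<bar> u) x)"
    using le assms by (intro summableI_nonneg_bounded dual_apply_nonneg) auto
  then show "(\<Sum>n. dual_apply (inf \<bar>f n\<bar> u) x) \<le> dual_apply u x"
    using le by (intro suminf_le_const)
qed

text \<open>Positive functionals map the truncations to the terms of a convergent series; every
  functional is a difference of two positive ones.\<close>

lemma disjoint_seq_uaw_null:
  fixes x :: "nat \<Rightarrow> 'a::banach_lattice"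
  assumes "disjoint_seq x"
  shows "uaw_null x"
  unfolding uaw_convergent_def weakly_convergent_def
proof (intro allI impI)
  fix u :: 'a and f :: "'a dual" assume u: "0 \<le> u"
  define a where "a n = inf \<bar>x n\<bar> u" for n
  have pos: "(\<lambda>n. dual_apply g (a n)) \<longlonglongrightarrow> 0" if "0 \<le> g" for g :: "'a dual"
    unfolding a_def by (rule summable_LIMSEQ_zero[OF summable_dual_apply_disjoint[OF assms u that]])
  have "(\<lambda>n. dual_apply (pprt f) (a n) - dual_apply (pprt (- f)) (a n)) \<longlonglongrightarrow> 0 - 0"
    by (intro tendsto_diff pos zero_le_pprt)
  then show "(\<lambda>n. dual_apply f (inf \<bar>x n - 0\<bar> u)) \<longlonglongrightarrow> dual_apply f 0"
    by (simp only: pprt_diff_pprt_minus flip: dual_apply_simps(3)) (simp add: a_def blinfun.zero_right)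
qed

text \<open>Here the vector is decomposed instead of the functional: at a positive vector the
  truncated functionals give the terms of a convergent series.\<close>

lemma disjoint_seq_uaw_star_null:
  fixes f :: "nat \<Rightarrow> 'a::banach_lattice dual"
  assumes "disjoint_seq f"
  shows "uaw_star_null f"
  unfolding uaw_star_convergent_def weak_star_convergent_def
proof (intro allI impI)
  fix u :: "'a dual" and x :: 'a assume u: "0 \<le> u"
  define g where "g n = inf \<bar>f n\<bar> u" for n
  have pos: "(\<lambda>n. dual_apply (g n) z) \<longlonglongrightarrow> 0" if "0 \<le> z" for z
    unfolding g_def by (rule summable_LIMSEQ_zero[OF summable_disjoint_dual_apply(1)[OF assms u that]])
  have "(\<lambda>n. dual_apply (g n) (pprt x) - dual_apply (g n) (pprt (- x))) \<longlonglongrightarrow> 0 - 0"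
    by (intro tendsto_diff pos zero_le_pprt)
  then show "(\<lambda>n. dual_apply (inf \<bar>f n - 0\<bar> u) x) \<longlonglongrightarrow> dual_apply 0 x"
    by (simp add: g_def flip: dual_apply_prts)
qed

text \<open>
  The order bound \<open>y n\<close> is the supremum of the tail, which by disjointness is the pointwise sum;
  pointwise tails of convergent series tend to \<open>0\<close>.
\<close>

lemma disjoint_seq_dual_uo_null:
  fixes f :: "nat \<Rightarrow> 'a::banach_lattice dual"
  assumes "disjoint_seq f"
  shows "uo_null f"
  unfolding uo_convergent_def
proof (intro allI impI)
  fix u :: "'a dual" assume u: "0 \<le> u"
  define g where "g n = inf \<bar>f n\<bar> u" for n
  have g0: "0 \<le> g n" for n
    using u by (simp add: g_def)
  have summ: "summable (\<lambda>n. dual_apply (g n) x)"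
    and sum_le: "(\<Sum>n. dual_apply (g n) x) \<le> dual_apply u x" if "0 \<le> x" for x
    using summable_disjoint_dual_apply[OF assms u that] by (simp_all add: g_def)
  \<comment> \<open>Comparison with the series at \<open>\<bar>x\<bar>\<close> extends summability
    from the cone to all vectors.\<close>
  have summ_abs: "summable (\<lambda>n. \<bar>dual_apply (g n) x\<bar>)" for x
    by (rule summable_comparison_test'[OF summ[OF abs_ge_zero[of x]]])
      (simp add: abs_dual_apply_le_abs g0)
  then have summ': "summable (\<lambda>k. dual_apply (g (k + n)) x)" for n x
    using summable_rabs_cancel summable_ignore_initial_segment by fast
  have bl: "bounded_linear (\<lambda>x. \<Sum>k. dual_apply (g (k + n)) x)" for n
  proof (rule bounded_linear_intro)
    fix x y :: 'a and r :: real
    show "(\<Sum>k. dual_apply (g (k + n)) (x + y))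
        = (\<Sum>k. dual_apply (g (k + n)) x) + (\<Sum>k. dual_apply (g (k + n)) y)"
      by (simp add: blinfun.add_right suminf_add[OF summ' summ'])
    show "(\<Sum>k. dual_apply (g (k + n)) (r *\<^sub>R x)) = r *\<^sub>R (\<Sum>k. dual_apply (g (k + n)) x)"
      by (simp add: blinfun.scaleR_right suminf_mult[OF summ'])
    have "norm (\<Sum>k. dual_apply (g (k + n)) x) \<le> (\<Sum>k. \<bar>dual_apply (g (k + n)) x\<bar>)"
      using summable_rabs summable_ignore_initial_segment[OF summ_abs] by fastforce
    also have "\<dots> \<le> (\<Sum>k. dual_apply (g (k + n)) \<bar>x\<bar>)"
      using summable_ignore_initial_segment[OF summ_abs] summ'
      by (intro suminf_le abs_dual_apply_le_abs g0) auto
    also have "\<dots> \<le> (\<Sum>k. dual_apply (g k) \<bar>x\<bar>)"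
      using suminf_split_initial_segment[OF summ[OF abs_ge_zero[of x]], of n]
      by (simp add: sum_nonneg dual_apply_nonneg g0)
    also have "\<dots> \<le> dual_apply u \<bar>x\<bar>"
      by (simp add: sum_le)
    also have "\<dots> \<le> norm u * norm x"
      using abs_dual_apply_le[of u "\<bar>x\<bar>"] by simp
    finally show "norm (\<Sum>k. dual_apply (g (k + n)) x) \<le> norm x * norm u"
      by (simp add: mult.commute)
  qed
  define y where "y n = dual_of_blinfun (Blinfun (\<lambda>x. \<Sum>k. dual_apply (g (k + n)) x))" for n
  have y: "dual_apply (y n) x = (\<Sum>k. dual_apply (g (k + n)) x)" for n x
    by (simp add: y_def dual_of_blinfun_inverse bounded_linear_Blinfun_apply[OF bl])
  have y_Suc: "dual_apply (y n) x = dual_apply (g n) x + dual_apply (y (Suc n)) x" for n x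
    using suminf_split_head[OF summ'[of n x]] by (simp add: y)
  have y_dec: "y (Suc n) \<le> y n" for n
    unfolding less_eq_dual_def using y_Suc[of n] dual_apply_nonneg[OF g0[of n]] by simp
  have y0: "0 \<le> y n" for n
    unfolding less_eq_dual_def y
    by (auto intro!: suminf_nonneg[OF summ'] dual_apply_nonneg g0)
  have y_lim: "(\<lambda>n. dual_apply (y n) x) \<longlonglongrightarrow> 0" for x
    unfolding y using suminf_exist_split2[OF summ'[of 0 x]] by simp
  have dec: "decreasing_net_0 UNIV (\<le>) y"
    unfolding decreasing_net_0_def
  proof (intro conjI ballI allI impI)
    show "directed_set (UNIV :: nat set) (\<le>)"
      unfolding directed_set_def reflp_on_def transp_on_def
      by auto (meson nat_le_linear order_refl)
    show "y j \<le> y i" if "i \<le> j" for i j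
      using that by (rule lift_Suc_antimono_le[of y, rotated]) (rule y_dec)
    show "0 \<le> y i" for i by (rule y0)
    fix z assume z: "\<forall>i\<in>UNIV. z \<le> y i"
    show "z \<le> 0"
      unfolding less_eq_dual_def
    proof (intro allI impI)
      fix x :: 'a assume "0 \<le> x"
      then have "dual_apply z x \<le> dual_apply (y n) x" for n
        using z by (intro dual_apply_leD) auto
      then show "dual_apply z x \<le> dual_apply 0 x"
        using LIMSEQ_le_const[OF y_lim[of x]] by simp
    qed
  qed
  have g_le: "g n \<le> y n" for n
    unfolding less_eq_dual_def using y_Suc[of n] dual_apply_nonneg[OF y0[of "Suc n"]] by simp
  \<comment> \<open>The net \<open>y\<close> is indexed by \<open>nat\<close>, whereas the
    definition takes indices from the dual itself; \<open>order_convergentI\<close> bridges the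
    two.\<close>
  show "order_convergent (\<lambda>n. inf \<bar>f n - 0\<bar> u) 0 sequentially"
  proof (rule order_convergentI[OF dec])
    fix i :: nat
    have "g n \<le> y i" if "i \<le> n" for n
      using g_le[of n] lift_Suc_antimono_le[of y, OF y_dec that] by (rule order_trans)
    then show "\<forall>\<^sub>F n in sequentially. \<bar>inf \<bar>f n - 0\<bar> u - 0\<bar> \<le> y i"
      using g0 by (auto simp: g_def eventually_sequentially intro!: exI[of _ i])
  qed
qed

section \<open>Disjoint norming functionals\<close>

text \<open>Every vector is a difference of two positive ones, and additivity on the cone makes the
  difference of the values independent of the representation.\<close>

lemma positive_functional_extension:
  fixes \<phi> :: "'a::banach_lattice \<Rightarrow> real"
  assumes add: "\<And>x y. 0 \<le> x \<Longrightarrow> 0 \<le> y \<Longrightarrow> \<phi> (x + y) = \<phi> x + \<phi> y"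
    and scaleR: "\<And>r x. 0 < r \<Longrightarrow> 0 \<le> x \<Longrightarrow> \<phi> (r *\<^sub>R x) = r * \<phi> x"
    and nonneg: "\<And>x. 0 \<le> x \<Longrightarrow> 0 \<le> \<phi> x"
    and bound: "\<And>x. 0 \<le> x \<Longrightarrow> \<phi> x \<le> K * norm x"
  obtains g :: "'a dual" where "\<And>x. 0 \<le> x \<Longrightarrow> dual_apply g x = \<phi> x"
proof -
  define \<psi> where "\<psi> x = \<phi> (pprt x) - \<phi> (pprt (- x))" for x
  have zero: "\<phi> 0 = 0"
    using add[of 0 0] by simp
  have diff: "\<psi> (a - b) = \<phi> a - \<phi> b" if "0 \<le> a" "0 \<le> b" for a b
  proof -
    have "pprt (a - b) + b = pprt (- (a - b)) + a"
      using pprt_diff_pprt_minus[of "a - b"] by (simp add: algebra_simps)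
    then have "\<phi> (pprt (a - b) + b) = \<phi> (pprt (- (a - b)) + a)"
      by simp
    then show ?thesis
      using that by (simp add: add \<psi>_def)
  qed
  have split: "x = pprt x - pprt (- x)" for x :: 'a
    by (simp only: pprt_diff_pprt_minus)
  have bl: "bounded_linear \<psi>"
  proof (rule bounded_linear_intro)
    fix x y :: 'a and r :: real
    have "x + y = (pprt x + pprt y) - (pprt (- x) + pprt (- y))"
      using split[of x] split[of y] by (simp only: algebra_simps) (metis add.left_commute add.commute)
    then have "\<psi> (x + y) = \<psi> ((pprt x + pprt y) - (pprt (- x) + pprt (- y)))"
      by simp
    also have "\<dots> = \<phi> (pprt x + pprt y) - \<phi> (pprt (- x) + pprt (- y))"
      by (intro diff add_nonneg_nonneg zero_le_pprt)
    finally show "\<psi> (x + y) = \<psi> x + \<psi> y"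
      by (simp add: add \<psi>_def)
    have pos: "\<psi> (s *\<^sub>R z) = s * \<psi> z" if "0 < s" for s z
    proof -
      have "\<psi> (s *\<^sub>R z) = \<psi> (s *\<^sub>R pprt z - s *\<^sub>R pprt (- z))"
        by (simp only: pprt_diff_pprt_minus flip: scaleR_diff_right)
      also have "\<dots> = \<phi> (s *\<^sub>R pprt z) - \<phi> (s *\<^sub>R pprt (- z))"
        using that by (intro diff scaleR_nonneg_nonneg zero_le_pprt) auto
      finally show ?thesis
        using that by (simp add: scaleR \<psi>_def right_diff_distrib)
    qed
    have minus: "\<psi> (- z) = - \<psi> z" for z
      by (simp add: \<psi>_def)
    consider "r = 0" | "0 < r" | "0 < - r" by linarith
    then show "\<psi> (r *\<^sub>R x) = r *\<^sub>R \<psi> x"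
    proof cases
      case 3
      then have "\<psi> ((- r) *\<^sub>R x) = (- r) * \<psi> x"
        by (rule pos)
      then show ?thesis
        using minus[of "r *\<^sub>R x"] by simp
    qed (simp_all add: \<psi>_def zero pos[unfolded \<psi>_def])
    \<comment> \<open>Both terms of \<open>\<psi> x\<close> are non-negative, so a bound on each
      bounds the modulus of their difference by the same constant.\<close>
    have "\<phi> (pprt z) \<le> norm z * \<bar>K\<bar>" for z
    proof -
      have "\<phi> (pprt z) \<le> K * norm (pprt z)"
        by (intro bound zero_le_pprt)
      also have "\<dots> \<le> \<bar>K\<bar> * norm z"
        using norm_pprt_le[of z] by (intro mult_mono) auto
      finally show ?thesis
        by (simp add: mult.commute)
    qed
    from this[of x] this[of "- x"] show "norm (\<psi> x) \<le> norm x * \<bar>K\<bar>"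
      using nonneg[OF zero_le_pprt, of x] nonneg[OF zero_le_pprt, of "- x"]
      by (simp add: \<psi>_def abs_le_iff)
  qed
  show thesis
  proof (rule that)
    fix x :: 'a assume "0 \<le> x"
    then show "dual_apply (dual_of_blinfun (Blinfun \<psi>)) x = \<phi> x"
      using diff[of x 0]
      by (simp add: dual_of_blinfun_inverse bounded_linear_Blinfun_apply[OF bl] zero)
  qed
qed

text \<open>For \<open>0 \<le> y\<close>, this is the part of the order interval from
  \<open>0\<close> to \<open>x\<close> that lies in the principal ideal generated by
  \<open>y\<close>.\<close>

definition ideal_interval :: "'a::banach_lattice \<Rightarrow> 'a \<Rightarrow> 'a set" where
  "ideal_interval y x = {z. 0 \<le> z \<and> z \<le> x \<and> (\<exists>t\<ge>0. z \<le> t *\<^sub>R y)}"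

lemma ideal_interval_add:
  assumes "u \<in> ideal_interval y x" "v \<in> ideal_interval y z"
  shows "u + v \<in> ideal_interval y (x + z)"
proof -
  obtain s t where st: "0 \<le> s" "u \<le> s *\<^sub>R y" "0 \<le> t" "v \<le> t *\<^sub>R y"
    using assms by (auto simp: ideal_interval_def)
  then have "u + v \<le> (s + t) *\<^sub>R y"
    by (simp add: scaleR_add_left add_mono)
  with st show ?thesis
    using assms unfolding ideal_interval_def
    by (auto intro!: add_mono exI[of _ "s + t"])
qed

lemma ideal_interval_scaleR:
  assumes "0 < r" "z \<in> ideal_interval y x"
  shows "r *\<^sub>R z \<in> ideal_interval y (r *\<^sub>R x)"
proof -
  obtain t where t: "0 \<le> t" "z \<le> t *\<^sub>R y"
    using assms by (auto simp: ideal_interval_def)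
  then have "r *\<^sub>R z \<le> (r * t) *\<^sub>R y"
    using assms(1) scaleR_left_mono[of z "t *\<^sub>R y" r] by simp
  with t show ?thesis
    using assms unfolding ideal_interval_def
    by (auto intro!: scaleR_left_mono scaleR_nonneg_nonneg exI[of _ "r * t"])
qed

lemma ideal_interval_mono:
  "z \<in> ideal_interval y x \<Longrightarrow> 0 \<le> w \<Longrightarrow> w \<le> z \<Longrightarrow> w \<le> x' \<Longrightarrow> w \<in> ideal_interval y x'"
  unfolding ideal_interval_def by (auto intro: order_trans)

text \<open>
  The last two properties say that \<open>g x\<close> is the supremum of \<open>f\<close> on \<open>ideal_interval y x\<close>: \<open>g\<close> is
  the part of \<open>f\<close> that lives on the ideal generated by \<open>y\<close>.
\<close>

lemma functional_component:
  fixes f :: "'a::banach_lattice dual"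
  assumes "0 \<le> f" "0 \<le> y"
  obtains g :: "'a dual" where "0 \<le> g" "g \<le> f"
    "\<And>x z. 0 \<le> x \<Longrightarrow> z \<in> ideal_interval y x \<Longrightarrow> dual_apply f z \<le> dual_apply g x"
    "\<And>x c. 0 \<le> x \<Longrightarrow> (\<And>z. z \<in> ideal_interval y x \<Longrightarrow> dual_apply f z \<le> c) \<Longrightarrow> dual_apply g x \<le> c"
proof -
  define \<phi> where "\<phi> x = Sup (dual_apply f ` ideal_interval y x)" for x
  have f_le: "dual_apply f z \<le> dual_apply f x" if "z \<in> ideal_interval y x" for x z
    using that assms by (auto simp: ideal_interval_def intro: dual_apply_mono)
  have zero_mem: "0 \<in> ideal_interval y x" if "0 \<le> x" for x
    using that by (auto simp: ideal_interval_def intro: exI[of _ 0])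
  have upper: "dual_apply f z \<le> \<phi> x" if "z \<in> ideal_interval y x" for x z
    unfolding \<phi>_def using that
    by (intro cSup_upper imageI) (auto intro!: bdd_aboveI2 f_le)
  have least: "\<phi> x \<le> c" if "0 \<le> x" "\<And>z. z \<in> ideal_interval y x \<Longrightarrow> dual_apply f z \<le> c" for x c
    unfolding \<phi>_def using that zero_mem[OF that(1)] by (intro cSup_least) auto
  have \<phi>_le: "\<phi> x \<le> dual_apply f x" if "0 \<le> x" for x
    by (rule least[OF that f_le])
  have nonneg: "0 \<le> \<phi> x" if "0 \<le> x" for x
    using upper[OF zero_mem[OF that]] by (simp add: blinfun.zero_right)
  have add: "\<phi> (x + z) = \<phi> x + \<phi> z" if xz: "0 \<le> x" "0 \<le> z" for x z
  proof (rule order.antisym)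
    show "\<phi> (x + z) \<le> \<phi> x + \<phi> z"
    proof (rule least)
      fix w assume w: "w \<in> ideal_interval y (x + z)"
      then have w0: "0 \<le> w" "w \<le> x + z"
        by (auto simp: ideal_interval_def)
      \<comment> \<open>Riesz decomposition of \<open>w\<close> into \<open>inf w x\<close> and a
        remainder below \<open>z\<close>; both pieces stay below \<open>w\<close>, hence in the
        ideal generated by \<open>y\<close>.\<close>
      have "w - inf w x = sup 0 (w - x)"
        by (simp add: diff_inf_eq_sup add_sup_distrib_left)
      also have "\<dots> \<le> z"
        using w0 xz by (simp add: algebra_simps)
      finally have "w - inf w x \<le> z" .
      moreover have "0 \<le> w - inf w x" "w - inf w x \<le> w"
        using w0 xz by (simp_all only: diff_ge_0_iff_ge inf_le1 diff_le_eq le_add_same_cancel1 le_inf_iff)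
      ultimately have "w - inf w x \<in> ideal_interval y z"
        by (intro ideal_interval_mono[OF w])
      moreover have "inf w x \<in> ideal_interval y x"
        using w0 xz by (intro ideal_interval_mono[OF w]) auto
      ultimately have "dual_apply f (inf w x) + dual_apply f (w - inf w x) \<le> \<phi> x + \<phi> z"
        by (intro add_mono upper)
      then show "dual_apply f w \<le> \<phi> x + \<phi> z"
        unfolding blinfun.diff_right by simp
    qed (use xz in simp)
  next
    have "dual_apply f u + dual_apply f v \<le> \<phi> (x + z)"
      if "u \<in> ideal_interval y x" "v \<in> ideal_interval y z" for u v
      using upper[OF ideal_interval_add[OF that]] by (simp add: blinfun.add_right)
    then have "dual_apply f v \<le> \<phi> (x + z) - dual_apply f u"
      if "u \<in> ideal_interval y x" "v \<in> ideal_interval y z" for u v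
      using that by (simp add: algebra_simps)
    then have "\<phi> z \<le> \<phi> (x + z) - dual_apply f u" if "u \<in> ideal_interval y x" for u
      using that xz by (intro least) auto
    then have "dual_apply f u \<le> \<phi> (x + z) - \<phi> z" if "u \<in> ideal_interval y x" for u
      using that by (simp add: algebra_simps)
    then have "\<phi> x \<le> \<phi> (x + z) - \<phi> z"
      using xz by (intro least) auto
    then show "\<phi> x + \<phi> z \<le> \<phi> (x + z)"
      by simp
  qed
  have scaleR_le: "r * \<phi> x \<le> \<phi> (r *\<^sub>R x)" if "0 < r" "0 \<le> x" for r x
  proof -
    have "\<phi> x \<le> \<phi> (r *\<^sub>R x) / r"
    proof (rule least)
      fix z assume "z \<in> ideal_interval y x"
      from upper[OF ideal_interval_scaleR[OF that(1) this]]
      show "dual_apply f z \<le> \<phi> (r *\<^sub>R x) / r"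
        using that by (simp add: blinfun.scaleR_right field_simps)
    qed fact
    then show ?thesis
      using that by (simp add: field_simps)
  qed
  have scaleR: "\<phi> (r *\<^sub>R x) = r * \<phi> x" if "0 < r" "0 \<le> x" for r x
  proof (rule order.antisym[OF _ scaleR_le[OF that]])
    have "inverse r * \<phi> (r *\<^sub>R x) \<le> \<phi> (inverse r *\<^sub>R r *\<^sub>R x)"
      using that by (intro scaleR_le scaleR_nonneg_nonneg) auto
    then show "\<phi> (r *\<^sub>R x) \<le> r * \<phi> x"
      using that by (simp add: field_simps)
  qed
  have bound: "\<phi> x \<le> norm f * norm x" if "0 \<le> x" for x
    using \<phi>_le[OF that] abs_dual_apply_le[of f x] by linarith
  obtain g :: "'a dual" where g: "\<And>x. 0 \<le> x \<Longrightarrow> dual_apply g x = \<phi> x"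
    using positive_functional_extension[OF add scaleR nonneg bound] by blast
  show thesis
  proof (rule that[of g])
    show "0 \<le> g" "g \<le> f"
      by (simp_all add: less_eq_dual_def g nonneg \<phi>_le)
  qed (simp_all add: g upper least)
qed

text \<open>An element below multiples of both \<open>x\<close> and \<open>y\<close> is, after
  scaling, below \<open>inf x y\<close>: the principal ideals of disjoint elements meet only in
  \<open>0\<close>.\<close>

lemma ideal_interval_disjoint:
  fixes x y :: "'a::banach_lattice"
  assumes "0 \<le> x" "0 \<le> y" "inf x y = 0" "v \<in> ideal_interval x u" "z \<in> ideal_interval y v"
  shows "z = 0"
proof -
  obtain s t where st: "0 \<le> s" "v \<le> s *\<^sub>R x" "0 \<le> t" "z \<le> t *\<^sub>R y" and z: "0 \<le> z" "z \<le> v"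
    using assms by (auto simp: ideal_interval_def)
  \<comment> \<open>A common multiple for both bounds; the \<open>+ 1\<close> makes it
    invertible.\<close>
  define r where "r = s + t + 1"
  have "s *\<^sub>R x \<le> r *\<^sub>R x" "t *\<^sub>R y \<le> r *\<^sub>R y"
    using assms st by (auto simp: r_def intro!: scaleR_right_mono)
  with st z have "z \<le> r *\<^sub>R x" "z \<le> r *\<^sub>R y"
    by (meson order_trans)+
  moreover have r: "0 < r"
    using st by (simp add: r_def)
  ultimately have "inverse r *\<^sub>R z \<le> inverse r *\<^sub>R r *\<^sub>R x" "inverse r *\<^sub>R z \<le> inverse r *\<^sub>R r *\<^sub>R y"
    by (intro scaleR_left_mono; simp)+
  with r have "inverse r *\<^sub>R z \<le> x" "inverse r *\<^sub>R z \<le> y"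
    by simp_all
  then have "inverse r *\<^sub>R z \<le> 0"
    using assms(3) by (metis inf_greatest)
  moreover have "0 \<le> inverse r *\<^sub>R z"
    using r z by (intro scaleR_nonneg_nonneg) auto
  ultimately have "inverse r *\<^sub>R z = 0"
    by (rule order.antisym)
  then show ?thesis
    using r by simp
qed

text \<open>The component of a norming functional on the ideal of \<open>x n\<close> still norms
  \<open>x n\<close>, which lies in that ideal. It vanishes on the ideals of the other
  \<open>x m\<close>, which makes the components disjoint.\<close>

lemma disjoint_norming_functionals:
  fixes x :: "nat \<Rightarrow> 'a::banach_lattice"
  assumes disj: "disjoint_seq x" and x0: "\<And>n. 0 \<le> x n"
  obtains f :: "nat \<Rightarrow> 'a dual" where "disjoint_seq f" "bounded (range f)"
    "\<And>n. dual_apply (f n) (x n) = norm (x n)"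
proof -
  have "\<exists>h :: 'a dual. 0 \<le> h \<and> norm h \<le> 1 \<and> dual_apply h (x n) = norm (x n)" for n
    using norming_positive_functional[OF x0] by blast
  then obtain h :: "nat \<Rightarrow> 'a dual" where h: "\<And>n. 0 \<le> h n" "\<And>n. norm (h n) \<le> 1"
    "\<And>n. dual_apply (h n) (x n) = norm (x n)"
    by metis
  have "\<exists>g. 0 \<le> g \<and> g \<le> h n
      \<and> (\<forall>u z. 0 \<le> u \<longrightarrow> z \<in> ideal_interval (x n) u \<longrightarrow> dual_apply (h n) z \<le> dual_apply g u)
      \<and> (\<forall>u c. 0 \<le> u \<longrightarrow> (\<forall>z \<in> ideal_interval (x n) u. dual_apply (h n) z \<le> c) \<longrightarrow> dual_apply g u \<le> c)" for n
    by (rule functional_component[OF h(1)[of n] x0[of n]]) blast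
  then obtain f where f0: "\<And>n. 0 \<le> f n" and f_le: "\<And>n. f n \<le> h n"
    and upper: "\<And>n u z. 0 \<le> u \<Longrightarrow> z \<in> ideal_interval (x n) u \<Longrightarrow> dual_apply (h n) z \<le> dual_apply (f n) u"
    and least: "\<And>n u c. 0 \<le> u \<Longrightarrow> (\<And>z. z \<in> ideal_interval (x n) u \<Longrightarrow> dual_apply (h n) z \<le> c) \<Longrightarrow> dual_apply (f n) u \<le> c"
    by metis
  show thesis
  proof (rule that[of f])
    have "norm (f n) \<le> 1" for n
      using norm_mono_pos[OF f0 f_le, of n] h(2)[of n] by linarith
    then show "bounded (range f)"
      by (auto simp: bounded_iff)
    show "dual_apply (f n) (x n) = norm (x n)" for n
    proof (rule order.antisym)
      show "dual_apply (f n) (x n) \<le> norm (x n)"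
        using dual_apply_leD[OF f_le x0] h(3) by metis
      have "x n \<in> ideal_interval (x n) (x n)"
        using x0 by (auto simp: ideal_interval_def intro: exI[of _ 1])
      then show "norm (x n) \<le> dual_apply (f n) (x n)"
        using upper[OF x0] h(3) by metis
    qed
    have "inf (f n) (f m) \<le> 0" if "m \<noteq> n" for m n
      unfolding less_eq_dual_def
    proof (intro allI impI)
      fix u :: 'a assume u: "0 \<le> u"
      have xmn: "inf (x m) (x n) = 0"
        using disj that x0 by (simp add: disjoint_seq_def)
      \<comment> \<open>Splitting \<open>u\<close> as \<open>(u - v) + v\<close> with
        \<open>v\<close> in the ideal of \<open>x m\<close>, where \<open>f n\<close> vanishes,
        bounds the infimum by \<open>f m\<close> at \<open>u - v\<close>. Taking the supremum over
        \<open>v\<close> leaves \<open>f m u\<close> on both sides and so a non-positive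
        infimum.\<close>
      have "dual_apply (f m) u \<le> dual_apply (f m) u - dual_apply (inf (f n) (f m)) u"
      proof (rule least[OF u])
        fix v assume v: "v \<in> ideal_interval (x m) u"
        then have v0: "0 \<le> v" "v \<le> u"
          by (auto simp: ideal_interval_def)
        have "dual_apply (f n) v \<le> 0"
        proof (rule least[OF v0(1)])
          fix z assume "z \<in> ideal_interval (x n) v"
          then have "z = 0"
            by (rule ideal_interval_disjoint[OF x0 x0 xmn v])
          then show "dual_apply (h n) z \<le> 0"
            by (simp add: blinfun.zero_right)
        qed
        moreover have "dual_apply (h m) v \<le> dual_apply (f m) v"
          using v0 by (intro upper ideal_interval_mono[OF v]) auto
        moreover have "dual_apply (inf (f m) (f n)) u \<le> dual_apply (f m) (u - v) + dual_apply (f n) v"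
          using v0 by (rule inf_dual_apply_le)
        ultimately show "dual_apply (h m) v \<le> dual_apply (f m) u - dual_apply (inf (f n) (f m)) u"
          by (simp add: blinfun.diff_right inf_commute)
      qed
      then show "dual_apply (inf (f n) (f m)) u \<le> dual_apply 0 u"
        by simp
    qed
    then show "disjoint_seq f"
      using f0 by (auto simp: disjoint_seq_def intro!: order.antisym)
  qed
qed

section \<open>Disjoint elements for disjoint functionals\<close>

text \<open>The Banach-Alaoglu argument: evaluation maps a bounded family into a product of compact
  intervals. A finer filter replaces a subsequence, since weak* compactness need not provide
  convergent subsequences.\<close>

lemma weak_star_cluster_point:
  fixes f :: "'i \<Rightarrow> 'a::banach_lattice dual"
  assumes "bounded (range f)" "F \<noteq> bot"
  obtains G l where "G \<le> F" "G \<noteq> bot" "weak_star_convergent f l G"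
proof -
  obtain M where M: "\<And>i. norm (f i) \<le> M"
    using assms(1) by (auto simp: bounded_iff)
  define e where "e i = (\<lambda>x. dual_apply (f i) x)" for i
  define S where "S = (\<Pi>\<^sub>E x\<in>(UNIV :: 'a set). {- (M * norm x)..M * norm x})"
  have bnd: "\<bar>dual_apply (f i) x\<bar> \<le> M * norm x" for i x
    using abs_dual_apply_le[of "f i" x] mult_right_mono[OF M[of i] norm_ge_zero[of x]] by linarith
  have "compactin (product_topology (\<lambda>x::'a. euclidean :: real topology) UNIV) S"
    unfolding S_def by (subst compactin_PiE) auto
  then have "compact S"
    by (simp add: euclidean_product_topology compactin_euclidean_iff)
  moreover have "filtermap e F \<noteq> bot"
    using assms(2) by (simp add: filtermap_bot_iff)
  moreover have "eventually (\<lambda>h. h \<in> S) (filtermap e F)"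
    using bnd by (auto simp: eventually_filtermap e_def S_def abs_le_iff minus_le_iff intro!: always_eventually)
  ultimately obtain h where h: "inf (nhds h) (filtermap e F) \<noteq> bot"
    unfolding compact_filter by blast
  \<comment> \<open>\<open>G\<close> joins \<open>F\<close> with the pulled-back neighbourhoods of
    \<open>h\<close>; it is proper because \<open>h\<close> is a cluster point of \<open>e\<close>
    along \<open>F\<close>.\<close>
  define G where "G = inf F (filtercomap e (nhds h))"
  have "G \<le> F"
    by (simp add: G_def)
  have "G \<noteq> bot"
  proof
    assume "G = bot"
    then have "eventually (\<lambda>_. False) (inf F (filtercomap e (nhds h)))"
      by (simp add: G_def)
    then obtain P Q where P: "eventually P F" and Q: "eventually Q (filtercomap e (nhds h))"
      and PQ: "\<And>i. P i \<Longrightarrow> Q i \<Longrightarrow> False"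
      by (auto simp: eventually_inf)
    obtain R where R: "eventually R (nhds h)" "\<And>i. R (e i) \<Longrightarrow> Q i"
      using Q by (auto simp: eventually_filtercomap)
    have "eventually (\<lambda>k. \<not> R k) (filtermap e F)"
      unfolding eventually_filtermap using P by eventually_elim (use PQ R in blast)
    then have "eventually (\<lambda>_. False) (inf (nhds h) (filtermap e F))"
      unfolding eventually_inf using R(1) by blast
    with h show False
      by (simp add: eventually_False)
  qed
  have "(e \<longlongrightarrow> h) G"
    unfolding G_def by (meson filterlim_filtercomap filterlim_mono inf_le2 order_refl)
  then have lim: "((\<lambda>i. dual_apply (f i) x) \<longlongrightarrow> h x) G" for x
    using continuous_on_tendsto_compose[OF continuous_on_product_coordinates, of e h G x]
    by (simp add: e_def)
  have bl: "bounded_linear h"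
  proof (rule bounded_linear_intro)
    fix x y :: 'a and r :: real
    show "h (x + y) = h x + h y"
      using tendsto_unique[OF \<open>G \<noteq> bot\<close> lim[of "x + y"]] tendsto_add[OF lim[of x] lim[of y]]
      by (simp add: blinfun.add_right)
    show "h (r *\<^sub>R x) = r *\<^sub>R h x"
      using tendsto_unique[OF \<open>G \<noteq> bot\<close> lim[of "r *\<^sub>R x"]] tendsto_scaleR[OF tendsto_const lim[of x]]
      by (simp add: blinfun.scaleR_right)
    show "norm (h x) \<le> norm x * M"
      using bnd[of _ x]
      by (intro tendsto_upperbound[OF tendsto_norm[OF lim[of x]] _ \<open>G \<noteq> bot\<close>])
        (auto simp: mult.commute)
  qed
  have "weak_star_convergent f (dual_of_blinfun (Blinfun h)) G"
    unfolding weak_star_convergent_def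
    by (simp add: lim dual_of_blinfun_inverse bounded_linear_Blinfun_apply[OF bl])
  with \<open>G \<le> F\<close> \<open>G \<noteq> bot\<close> show thesis
    by (rule that)
qed

text \<open>Adding \<open>nprt x\<close> shifts the two entries to \<open>x\<close> and
  \<open>0\<close>, whose infimum is \<open>nprt x\<close> itself.\<close>

lemma inf_pprt_pprt_minus: "inf (pprt x) (pprt (- x)) = 0" for x :: "'a::banach_lattice"
proof -
  have "inf (pprt x) (pprt (- x)) + nprt x = inf (pprt x + nprt x) (pprt (- x) + nprt x)"
    by (rule add_inf_distrib_right)
  also have "\<dots> = inf x 0"
    by (simp only: prts[symmetric] pprt_neg) simp
  finally show ?thesis
    by (simp add: nprt_def)
qed

text \<open>The second entry is at most a multiple of the negative part of
  \<open>x - r *\<^sub>R y\<close>, which is disjoint from the positive part. Both constructions of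
  disjoint elements below rely on this.\<close>

lemma inf_pprt_diff_eq_0:
  fixes x y :: "'a::banach_lattice"
  assumes "0 < r"
  shows "inf (pprt (x - r *\<^sub>R y)) (pprt (y - inverse r *\<^sub>R x)) = 0"
proof -
  define a b c where "a = pprt (x - r *\<^sub>R y)" and "b = pprt (y - inverse r *\<^sub>R x)"
    and "c = pprt (r *\<^sub>R y - x)"
  have nonneg: "0 \<le> a" "0 \<le> b" "0 \<le> c"
    by (simp_all add: a_def b_def c_def)
  have ac: "inf a c = 0"
    using inf_pprt_pprt_minus[of "x - r *\<^sub>R y"] by (simp add: a_def c_def)
  have "y - inverse r *\<^sub>R x = inverse r *\<^sub>R (r *\<^sub>R y - x)"
    using assms by (simp add: scaleR_diff_right)
  then have b: "b \<le> inverse r *\<^sub>R c"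
    using assms pprt_scaleR[of "inverse r" "r *\<^sub>R y - x"] by (simp add: b_def c_def)
  \<comment> \<open>The element \<open>inf a b\<close> serves both as \<open>v\<close> and as
    \<open>z\<close> in \<open>ideal_interval_disjoint\<close>.\<close>
  have "inf a b \<in> ideal_interval a (inf a b)"
    using nonneg by (auto simp: ideal_interval_def intro: exI[of _ 1])
  moreover have "inf a b \<le> inverse r *\<^sub>R c"
    using b by (rule le_infI2)
  then have "inf a b \<in> ideal_interval c (inf a b)"
    using nonneg assms by (auto simp: ideal_interval_def intro!: exI[of _ "inverse r"])
  ultimately have "inf a b = 0"
    by (rule ideal_interval_disjoint[OF nonneg(1,3) ac])
  then show ?thesis
    by (simp add: a_def b_def)
qed

text \<open>The negative part of the limit has norm at most \<open>norm (X n - x)\<close>, so the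
  positive cone is closed.\<close>

lemma LIMSEQ_nonneg:
  fixes X :: "nat \<Rightarrow> 'a::banach_lattice"
  assumes "X \<longlonglongrightarrow> x" "\<And>n. 0 \<le> X n"
  shows "0 \<le> x"
proof -
  have "norm (pprt (- x)) \<le> norm (X n - x)" for n
  proof -
    have "pprt (- x) \<le> pprt (X n - x)"
      using assms(2)[of n] by (intro pprt_mono) simp
    then show ?thesis
      using norm_mono_pos[OF zero_le_pprt, of "- x"] norm_pprt_le[of "X n - x"] order_trans by blast
  qed
  moreover have "(\<lambda>n. norm (X n - x)) \<longlonglongrightarrow> 0"
    using assms(1) by (simp add: tendsto_norm_zero LIM_zero)
  ultimately have "norm (pprt (- x)) \<le> 0"
    by (intro LIMSEQ_le_const) auto
  then show ?thesis
    by (simp add: le_zero_iff_zero_pprt[of "- x", simplified])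
qed

lemma nth_le_suminf_nonneg:
  fixes b :: "nat \<Rightarrow> 'a::banach_lattice"
  assumes "summable b" "\<And>n. 0 \<le> b n"
  shows "b i \<le> suminf b"
proof -
  \<comment> \<open>The shift by \<open>Suc i\<close> puts \<open>b i\<close> into every partial
    sum.\<close>
  have "(\<lambda>n. (\<Sum>j<n + Suc i. b j) - b i) \<longlonglongrightarrow> suminf b - b i"
    by (intro tendsto_diff tendsto_const LIMSEQ_ignore_initial_segment summable_LIMSEQ assms)
  moreover have "0 \<le> (\<Sum>j<n + Suc i. b j) - b i" for n
    using sum_mono2[of "{..<n + Suc i}" "{i}" b] assms(2) by simp
  ultimately have "0 \<le> suminf b - b i"
    by (rule LIMSEQ_nonneg)
  then show ?thesis by simp
qed

text \<open>A positive functional satisfies \<open>\<bar>f x\<bar> \<le> f \<bar>x\<bar>\<close>,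
  and \<open>\<bar>x\<bar>\<close> has the norm of \<open>x\<close>; so the positive part of the
  unit ball determines its norm.\<close>

lemma norm_dual_approx:
  fixes f :: "'a::banach_lattice dual"
  assumes "0 \<le> f" "c < norm f"
  obtains x where "0 \<le> x" "norm x \<le> 1" "c < dual_apply f x"
proof (rule ccontr)
  note witness = that
  assume "\<not> thesis"
  then have *: "dual_apply f x \<le> c" if "0 \<le> x" "norm x \<le> 1" for x
    using that witness[of x] not_less by blast
  have c: "0 \<le> c"
    using *[of 0] by (simp add: blinfun.zero_right)
  have "norm (blinfun_of_dual f) \<le> c"
  proof (rule norm_blinfun_bound[OF c])
    fix x :: 'a
    show "norm (dual_apply f x) \<le> c * norm x"
    proof (cases "x = 0")
      case False
      have "dual_apply f (inverse (norm x) *\<^sub>R \<bar>x\<bar>) \<le> c"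
        using False by (intro * scaleR_nonneg_nonneg) auto
      then have "dual_apply f \<bar>x\<bar> \<le> c * norm x"
        using False by (simp add: blinfun.scaleR_right field_simps)
      then show ?thesis
        using abs_dual_apply_le_abs[OF assms(1), of x] by simp
    qed (simp add: blinfun.zero_right)
  qed
  then show False
    using assms(2) by (simp add: norm_dual.rep_eq)
qed

text \<open>Along a sparse subsequence each functional is tiny on all earlier elements, so a large
  multiple of them may be subtracted; the multiple of \<open>z\<close> costs at most
  \<open>(1 / 2) ^ k\<close> times a constant. A fixed part of the value survives.\<close>

lemma disjoint_elements_if_weak_star_null:
  fixes f :: "nat \<Rightarrow> 'a::banach_lattice dual"
  assumes f0: "\<And>n. 0 \<le> f n" and bdd: "bounded (range f)"
    and null: "\<And>u. 0 \<le> u \<Longrightarrow> (\<lambda>n. dual_apply (f n) u) \<longlonglongrightarrow> 0"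
    and not_null: "\<not> f \<longlonglongrightarrow> 0"
  obtains r y where "strict_mono r" "\<And>k. 0 \<le> y k" "disjoint_seq y" "bounded (range y)"
    "\<not> (\<lambda>k. dual_apply (f (r k)) (y k)) \<longlonglongrightarrow> 0"
proof -
  obtain M where M: "\<And>n. norm (f n) \<le> M"
    using bdd by (auto simp: bounded_iff)
  obtain e where e: "0 < e" "\<And>N. \<exists>n\<ge>N. e \<le> norm (f n)"
    using not_null unfolding lim_sequentially by (auto simp: not_less)
  have "\<exists>x. 0 \<le> x \<and> norm x \<le> 1 \<and> norm (f n) - e / 2 < dual_apply (f n) x" for n
    by (rule norm_dual_approx[OF f0, of "norm (f n) - e / 2" n]) (use e in auto)
  then obtain x where x: "\<And>n. 0 \<le> x n" "\<And>n. norm (x n) \<le> 1"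
    "\<And>n. norm (f n) - e / 2 < dual_apply (f n) (x n)"
    by metis
  \<comment> \<open>The sum runs over all indices up to \<open>r k\<close>, not only the selected
    ones, so that the condition on \<open>r (Suc k)\<close> refers only to \<open>r k\<close> and
    \<open>k\<close>.\<close>
  have "\<exists>r. \<forall>k. e \<le> norm (f (r k)) \<and>
    (r k < r (Suc k) \<and> 4 ^ Suc k * dual_apply (f (r (Suc k))) (\<Sum>i\<le>r k. x i) < e / 8)"
  proof (rule dependent_nat_choice)
    show "\<exists>n. e \<le> norm (f n)" using e(2) by blast
    fix n k :: nat
    have "(\<lambda>m. 4 ^ Suc k * dual_apply (f m) (\<Sum>i\<le>n. x i)) \<longlonglongrightarrow> 0"
      using x(1) by (intro tendsto_mult_right_zero null sum_nonneg) auto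
    then have "\<forall>\<^sub>F m in sequentially. 4 ^ Suc k * dual_apply (f m) (\<Sum>i\<le>n. x i) < e / 8"
      by (rule order_tendstoD) (use e(1) in simp)
    then obtain N where "\<And>m. m \<ge> N \<Longrightarrow> 4 ^ Suc k * dual_apply (f m) (\<Sum>i\<le>n. x i) < e / 8"
      unfolding eventually_sequentially by blast
    moreover obtain m where "m \<ge> max N (Suc n)" "e \<le> norm (f m)"
      using e(2) by blast
    ultimately show "\<exists>m. e \<le> norm (f m) \<and> (n < m \<and> 4 ^ Suc k * dual_apply (f m) (\<Sum>i\<le>n. x i) < e / 8)"
      by (intro exI[of _ m]) auto
  qed
  then obtain r where r: "\<And>k. e \<le> norm (f (r k))" "\<And>k. r k < r (Suc k)"
    "\<And>k. 4 ^ Suc k * dual_apply (f (r (Suc k))) (\<Sum>i\<le>r k. x i) < e / 8"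
    by blast
  have mono: "strict_mono r"
    using r(2) by (simp add: strict_mono_Suc_iff)
  define a where "a k = x (r k)" for k
  define S where "S k = (\<Sum>i<k. a i)" for k
  \<comment> \<open>The weights make the series converge absolutely, so that a single
    \<open>z\<close> dominates every \<open>b i\<close>.\<close>
  define b where "b i = (1 / 2) ^ i *\<^sub>R a i" for i
  define z where "z = suminf b"
  have a0: "0 \<le> a k" for k
    by (simp add: a_def x(1))
  have b0: "0 \<le> b i" for i
    unfolding b_def by (intro scaleR_nonneg_nonneg a0) simp
  have "summable b"
  proof (rule summable_comparison_test')
    show "summable (\<lambda>i. (1 / 2 :: real) ^ i)" by (simp add: summable_geometric)
    show "norm (b i) \<le> (1 / 2) ^ i" for i
      using x(2)[of "r i"] by (simp add: b_def a_def mult_le_cancel_left1 divide_simps)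
  qed
  then have b_le: "b i \<le> z" for i
    unfolding z_def using b0 by (rule nth_le_suminf_nonneg)
  have z0: "0 \<le> z"
    using b0 b_le by (rule order_trans)
  have S0: "0 \<le> S k" for k
    unfolding S_def by (intro sum_nonneg a0)
  have S_small: "4 ^ k * dual_apply (f (r k)) (S k) \<le> e / 8" for k
  proof (cases k)
    case 0
    then show ?thesis using e by (simp add: S_def blinfun.zero_right)
  next
    case (Suc j)
    have "S k = (\<Sum>i\<in>r ` {..<k}. x i)"
      unfolding S_def a_def using strict_mono_imp_inj_on[OF mono]
      by (subst sum.reindex) (auto intro: inj_on_subset)
    also have "\<dots> \<le> (\<Sum>i\<le>r j. x i)"
      using Suc mono x(1) by (intro sum_mono2) (auto simp: strict_mono_less_eq)
    finally have "dual_apply (f (r k)) (S k) \<le> dual_apply (f (r k)) (\<Sum>i\<le>r j. x i)"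
      by (rule dual_apply_mono[OF f0])
    then have "4 ^ k * dual_apply (f (r k)) (S k) \<le> 4 ^ k * dual_apply (f (r k)) (\<Sum>i\<le>r j. x i)"
      by simp
    then show ?thesis
      using r(3)[of j] unfolding Suc by linarith
  qed
  \<comment> \<open>The term with \<open>S k\<close> separates \<open>y k\<close> from the earlier
    elements, the term with \<open>z\<close> from the later ones.\<close>
  define y where "y k = pprt (a k - 4 ^ k *\<^sub>R S k - (1 / 2) ^ k *\<^sub>R z)" for k
  have y0: "0 \<le> y k" for k
    by (simp add: y_def)
  have pos: "0 \<le> 4 ^ k *\<^sub>R S k" "0 \<le> (1 / 2) ^ k *\<^sub>R z" for k
    by (intro scaleR_nonneg_nonneg S0 z0; simp)+
  have y_le: "y k \<le> pprt (a k - 4 ^ k *\<^sub>R S k)" "y k \<le> pprt (a k - (1 / 2) ^ k *\<^sub>R z)" for k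
    using pos[of k] by (auto simp: y_def intro!: pprt_mono)
  have "pprt (a k - (1 / 2) ^ k *\<^sub>R z) \<le> pprt (a k)" for k
    using pos[of k] by (intro pprt_mono) simp
  then have y_le_a: "y k \<le> a k" for k
    using y_le(2)[of k] a0[of k] by (metis order_trans pprt_eq_id)
  show thesis
  proof (rule that[OF mono y0])
    show "disjoint_seq y"
    proof (rule disjoint_seq_nonnegI[OF y0])
      fix i k :: nat assume ik: "i < k"
      have "a i \<le> S k"
        unfolding S_def using ik a0 sum_mono2[of "{..<k}" "{i}" a] by simp
      then have "4 ^ k *\<^sub>R a i \<le> 4 ^ k *\<^sub>R S k"
        by (intro scaleR_left_mono) auto
      then have "pprt (a k - 4 ^ k *\<^sub>R S k) \<le> pprt (a k - 4 ^ k *\<^sub>R a i)"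
        by (intro pprt_mono diff_left_mono)
      with y_le(1)[of k] have 1: "y k \<le> pprt (a k - 4 ^ k *\<^sub>R a i)"
        by (rule order_trans)
      \<comment> \<open>One factor \<open>(1 / 2) ^ k\<close> turns \<open>a k\<close> into
        \<open>b k\<close>, the other is at most \<open>(1 / 2) ^ i\<close> because
        \<open>i < k\<close>. Thus \<open>(1 / 2) ^ i *\<^sub>R z\<close> dominates the multiple of
        \<open>a k\<close> that \<open>inf_pprt_diff_eq_0\<close> requires.\<close>
      have "inverse (4 ^ k) = (1 / 2 :: real) ^ k * (1 / 2) ^ k"
        by (simp add: power_one_over divide_simps flip: power_mult_distrib)
      also have "\<dots> \<le> (1 / 2) ^ i * (1 / 2) ^ k"
        using ik by (intro mult_right_mono power_decreasing) auto
      finally have "inverse (4 ^ k) *\<^sub>R a k \<le> ((1 / 2) ^ i * (1 / 2) ^ k) *\<^sub>R a k"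
        by (intro scaleR_right_mono a0)
      also have "\<dots> = (1 / 2) ^ i *\<^sub>R b k"
        by (simp add: b_def)
      also have "\<dots> \<le> (1 / 2) ^ i *\<^sub>R z"
        by (intro scaleR_left_mono b_le) simp
      finally have "pprt (a i - (1 / 2) ^ i *\<^sub>R z) \<le> pprt (a i - inverse (4 ^ k) *\<^sub>R a k)"
        by (intro pprt_mono diff_left_mono)
      with y_le(2)[of i] have 2: "y i \<le> pprt (a i - inverse (4 ^ k) *\<^sub>R a k)"
        by (rule order_trans)
      have "inf (y k) (y i) = 0"
        by (rule inf_eq_0_mono[OF inf_pprt_diff_eq_0 y0 1 y0 2]) simp
      then show "inf (y i) (y k) = 0"
        by (simp only: inf.commute)
    qed
    have "norm (y k) \<le> 1" for k
      using norm_mono_pos[OF y0 y_le_a, of k] x(2)[of "r k"] unfolding a_def by linarith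
    then show "bounded (range y)"
      by (auto simp: bounded_iff)
    \<comment> \<open>The value at \<open>a k\<close> exceeds \<open>e / 2\<close> and the term with
      \<open>S k\<close> removes at most \<open>e / 8\<close>, which leaves \<open>3 * e / 8\<close>
      up to a term that tends to \<open>0\<close>.\<close>
    have lower: "3 * e / 8 - (1 / 2) ^ k * (M * norm z) \<le> dual_apply (f (r k)) (y k)" for k
    proof -
      have "dual_apply (f (r k)) z \<le> M * norm z"
        using abs_dual_apply_le[of "f (r k)" z] mult_right_mono[OF M[of "r k"] norm_ge_zero[of z]]
        by linarith
      then have "(1 / 2) ^ k * dual_apply (f (r k)) z \<le> (1 / 2) ^ k * (M * norm z)"
        by (rule mult_left_mono) simp
      moreover have "dual_apply (f (r k)) (a k - 4 ^ k *\<^sub>R S k - (1 / 2) ^ k *\<^sub>R z) \<le> dual_apply (f (r k)) (y k)"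
        unfolding y_def by (intro dual_apply_mono f0) (simp add: pprt_def)
      then have "dual_apply (f (r k)) (a k) - 4 ^ k * dual_apply (f (r k)) (S k)
          - (1 / 2) ^ k * dual_apply (f (r k)) z \<le> dual_apply (f (r k)) (y k)"
        by (simp only: blinfun.diff_right blinfun.scaleR_right real_scaleR_def)
      moreover have "e / 2 < dual_apply (f (r k)) (a k)"
        using x(3)[of "r k"] r(1)[of k] unfolding a_def by linarith
      ultimately show ?thesis
        using S_small[of k] by linarith
    qed
    show "\<not> (\<lambda>k. dual_apply (f (r k)) (y k)) \<longlonglongrightarrow> 0"
    proof
      assume "(\<lambda>k. dual_apply (f (r k)) (y k)) \<longlonglongrightarrow> 0"
      moreover have "(\<lambda>k. 3 * e / 8 - (1 / 2) ^ k * (M * norm z)) \<longlonglongrightarrow> 3 * e / 8 - 0 * (M * norm z)"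
        by (intro tendsto_intros LIMSEQ_power_zero) simp
      ultimately have "3 * e / 8 - 0 * (M * norm z) \<le> 0"
        using lower by (intro LIMSEQ_le) auto
      then show False
        using e(1) by simp
    qed
  qed
qed

text \<open>
  A weak* cluster point \<open>l\<close> of \<open>f\<close> has \<open>l u > 0\<close>, and \<open>inf (f n) (C *\<^sub>R l)\<close> is disjoint and order
  bounded, hence small at \<open>v\<close> for large \<open>n\<close>. So \<open>v\<close> has a part \<open>z\<close> that carries most of \<open>f n\<close> and
  is nearly invisible to \<open>l\<close>; cutting \<open>z\<close> off \<open>v\<close> costs \<open>l\<close> little, and the selection can be
  repeated inside the remainder, which is disjoint from what has been chosen.
\<close>

lemma disjoint_elements_in_interval:
  fixes f :: "nat \<Rightarrow> 'a::banach_lattice dual"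
  assumes f0: "\<And>n. 0 \<le> f n" and disj: "disjoint_seq f" and bdd: "bounded (range f)"
    and u: "0 \<le> u" and not_null: "\<not> (\<lambda>n. dual_apply (f n) u) \<longlonglongrightarrow> 0"
  obtains r y where "strict_mono r" "\<And>k. 0 \<le> y k" "disjoint_seq y" "bounded (range y)"
    "\<not> (\<lambda>k. dual_apply (f (r k)) (y k)) \<longlonglongrightarrow> 0"
proof -
  obtain K where K: "0 < K" "\<And>n. norm (f n) \<le> K"
    using bdd unfolding bounded_pos by auto
  define C0 where "C0 = K * norm u + 1"
  have fu: "dual_apply (f n) u \<le> C0" for n
    using abs_dual_apply_le[of "f n" u] mult_right_mono[OF K(2)[of n] norm_ge_zero[of u]]
    unfolding C0_def by linarith
  have C0: "0 < C0"
    unfolding C0_def using K(1) by (simp add: add_nonneg_pos)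
  have nonneg: "0 \<le> dual_apply (f n) u" for n
    by (rule dual_apply_nonneg[OF f0 u])
  obtain c where c: "0 < c" "\<And>N. \<exists>n\<ge>N. c \<le> dual_apply (f n) u"
    using not_null nonneg unfolding lim_sequentially by (auto simp: not_less)
  \<comment> \<open>Half of \<open>c\<close>, so that \<open>d < dual_apply l u\<close> is strict;
    each selection step spends some of this slack and keeps the inequality strict on the
    remainder.\<close>
  define d where "d = c / 2"
  have d: "0 < d" "d < c" using c by (auto simp: d_def)
  \<comment> \<open>Restricting to indices with \<open>c \<le> dual_apply (f n) u\<close> forces the
    cluster point to be at least \<open>c\<close> at \<open>u\<close>.\<close>
  define F where "F = inf sequentially (principal {n. c \<le> dual_apply (f n) u})"
  have "F \<noteq> bot"
  proof
    assume "F = bot"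
    then have "\<forall>\<^sub>F n in sequentially. \<not> c \<le> dual_apply (f n) u"
      unfolding F_def by (simp add: trivial_limit_def eventually_inf_principal)
    with c(2) show False
      unfolding eventually_sequentially by blast
  qed
  then obtain G l where G: "G \<le> F" "G \<noteq> bot" "weak_star_convergent f l G"
    using weak_star_cluster_point[OF bdd] by blast
  then have lim: "((\<lambda>n. dual_apply (f n) v) \<longlongrightarrow> dual_apply l v) G" for v
    by (simp add: weak_star_convergent_def)
  have l0: "0 \<le> l"
    unfolding less_eq_dual_def
    using tendsto_lowerbound[OF lim always_eventually G(2)] dual_apply_nonneg[OF f0] by simp
  have G_seq: "G \<le> sequentially"
    using G(1) unfolding F_def by simp
  have "\<forall>\<^sub>F n in F. c \<le> dual_apply (f n) u"
    by (simp add: F_def eventually_inf_principal)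
  then have "\<forall>\<^sub>F n in G. c \<le> dual_apply (f n) u"
    using G(1) by (simp add: filter_leD)
  then have "c \<le> dual_apply l u"
    using tendsto_lowerbound[OF lim _ G(2)] by blast
  with d have lu: "d < dual_apply l u"
    by simp
  have step: "\<exists>n y w. N < n \<and> 0 \<le> y \<and> y \<le> v \<and> 0 \<le> w \<and> w \<le> v \<and> inf y w = 0 \<and>
      d < dual_apply l w \<and> d / 2 \<le> dual_apply (f n) y"
    if v: "0 \<le> v" "v \<le> u" "d < dual_apply l v" for v and N :: nat
  proof -
    \<comment> \<open>\<open>C\<close> is chosen so that \<open>C0 / C = d / 4\<close>;
      \<open>s\<close> is a loss that both estimates below tolerate, that of \<open>l\<close> on the
      remainder and that of \<open>f n\<close> on the new element.\<close>
    define C where "C = 4 * C0 / d"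
    have C: "0 < C" using C0 d by (simp add: C_def)
    define s where "s = min (dual_apply l v - d) (d / 4)"
    have s: "0 < s" using v d by (simp add: s_def)
    have Cl: "0 \<le> C *\<^sub>R l"
      using C l0 by (intro scaleR_nonneg_nonneg) auto
    have "(\<lambda>n. dual_apply (inf \<bar>f n\<bar> (C *\<^sub>R l)) v) \<longlonglongrightarrow> 0"
      by (rule summable_LIMSEQ_zero[OF summable_disjoint_dual_apply(1)[OF disj Cl v(1)]])
    then have "\<forall>\<^sub>F n in sequentially. dual_apply (inf (f n) (C *\<^sub>R l)) v < s"
      using s f0 by (intro order_tendstoD) (simp_all add: abs_of_nonneg)
    then have "\<forall>\<^sub>F n in G. dual_apply (inf (f n) (C *\<^sub>R l)) v < s"
      using G_seq by (rule filter_leD[rotated])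
    moreover have "\<forall>\<^sub>F n in G. N < n"
      using eventually_gt_at_top[of N] G_seq by (rule filter_leD[rotated])
    moreover have "\<forall>\<^sub>F n in G. d < dual_apply (f n) v"
      using v(3) by (rule order_tendstoD[OF lim])
    ultimately have "\<forall>\<^sub>F n in G. dual_apply (inf (f n) (C *\<^sub>R l)) v < s \<and> N < n \<and> d < dual_apply (f n) v"
      by eventually_elim simp
    from eventually_happens'[OF G(2) this] obtain n
      where n: "dual_apply (inf (f n) (C *\<^sub>R l)) v < s" "N < n" "d < dual_apply (f n) v"
      by blast
    obtain z where z: "0 \<le> z" "z \<le> v" "dual_apply (f n) (v - z) + dual_apply (C *\<^sub>R l) z < s"
      by (rule inf_dual_approx[OF v(1) n(1)])
    \<comment> \<open>These are disjoint by \<open>inf_pprt_diff_eq_0\<close>. Passing from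
      \<open>v\<close> to \<open>w\<close> costs \<open>l\<close> less than \<open>s\<close>;
      passing from \<open>v\<close> to \<open>y\<close> costs \<open>f n\<close> at most
      \<open>s + d / 4\<close>, out of a value above \<open>d\<close>.\<close>
    define y where "y = pprt (z - inverse C *\<^sub>R v)"
    define w where "w = pprt (v - C *\<^sub>R z)"
    have z1: "dual_apply (f n) (v - z) < s"
      using z dual_apply_nonneg[OF Cl z(1)] by linarith
    have z2: "C * dual_apply l z < s"
      using z dual_apply_nonneg[OF f0, of "v - z" n] by simp
    have "0 \<le> inverse C *\<^sub>R v" "0 \<le> C *\<^sub>R z"
      using C v z by (auto intro!: scaleR_nonneg_nonneg)
    then have "y \<le> pprt z" "w \<le> pprt v"
      unfolding y_def w_def by (intro pprt_mono; simp)+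
    then have le: "y \<le> v" "w \<le> v"
      using z v by (auto intro: order_trans)
    have "inf w y = 0"
      unfolding w_def y_def by (rule inf_pprt_diff_eq_0[OF C])
    then have "inf y w = 0"
      by (simp only: inf.commute)
    moreover have "d < dual_apply l w"
    proof -
      have "dual_apply l (v - C *\<^sub>R z) \<le> dual_apply l w"
        unfolding w_def by (intro dual_apply_mono l0) (simp add: pprt_def)
      then have "dual_apply l v - C * dual_apply l z \<le> dual_apply l w"
        by (simp add: blinfun.diff_right blinfun.scaleR_right)
      moreover have "s \<le> dual_apply l v - d"
        by (simp add: s_def)
      ultimately show ?thesis
        using z2 by linarith
    qed
    moreover have "d / 2 \<le> dual_apply (f n) y"
    proof -
      have "dual_apply (f n) (z - inverse C *\<^sub>R v) \<le> dual_apply (f n) y"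
        unfolding y_def by (intro dual_apply_mono f0) (simp add: pprt_def)
      then have "dual_apply (f n) z - inverse C * dual_apply (f n) v \<le> dual_apply (f n) y"
        by (simp add: blinfun.diff_right blinfun.scaleR_right)
      moreover have "inverse C * dual_apply (f n) v \<le> inverse C * C0"
        using C fu[of n] dual_apply_mono[OF f0 v(2), of n] by (intro mult_left_mono) auto
      moreover have "inverse C * C0 = d / 4"
        using C0 d by (simp add: C_def)
      moreover have "dual_apply (f n) z = dual_apply (f n) v - dual_apply (f n) (v - z)"
        by (simp add: blinfun.diff_right)
      moreover have "s \<le> d / 4"
        by (simp only: s_def min.cobounded2)
      ultimately show ?thesis
        using z1 n(3) by linarith
    qed
    ultimately show ?thesis
      using n(2) le by (intro exI[of _ n] exI[of _ y] exI[of _ w]) (simp add: y_def w_def)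
  qed
  \<comment> \<open>The state of the selection: an index, the element chosen for it, and the
    remainder \<open>v\<close> below which later elements are sought.\<close>
  define P where "P = (\<lambda>(n, y, v). 0 \<le> y \<and> y \<le> u \<and> 0 \<le> v \<and> v \<le> u \<and> inf y v = 0 \<and>
      d < dual_apply l v \<and> d / 2 \<le> dual_apply (f n) y)"
  define Q where "Q = (\<lambda>(n :: nat, y :: 'a, v :: 'a) (n', y' :: 'a, v'). n < n' \<and> y' \<le> v \<and> v' \<le> v)"
  have "\<exists>t. \<forall>k::nat. P (t k) \<and> Q (t k) (t (Suc k))"
  proof (rule dependent_nat_choice)
    show "\<exists>s. P s"
      using step[OF u order_refl lu, of 0] unfolding P_def by fast
    fix s :: "nat \<times> 'a \<times> 'a" and k :: nat assume s: "P s"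
    obtain N y v where s_eq: "s = (N, y, v)"
      by (cases s)
    have v: "0 \<le> v" "v \<le> u" "d < dual_apply l v"
      using s by (auto simp: P_def s_eq)
    obtain n y' w where "N < n" "0 \<le> y'" "y' \<le> v" "0 \<le> w" "w \<le> v" "inf y' w = 0"
      "d < dual_apply l w" "d / 2 \<le> dual_apply (f n) y'"
      using step[OF v, of N] by blast
    with v show "\<exists>s'. P s' \<and> Q s s'"
      by (intro exI[of _ "(n, y', w)"]) (auto simp: P_def Q_def s_eq intro: order_trans)
  qed
  then obtain t where t: "\<And>k. P (t k)" "\<And>k. Q (t k) (t (Suc k))"
    by blast
  define r where "r k = fst (t k)" for k
  define y where "y k = fst (snd (t k))" for k
  define v where "v k = snd (snd (t k))" for k
  have P: "0 \<le> y k" "y k \<le> u" "0 \<le> v k" "inf (y k) (v k) = 0" "d / 2 \<le> dual_apply (f (r k)) (y k)" for k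
    using t(1)[of k] by (auto simp: P_def r_def y_def v_def case_prod_beta)
  have Q: "r k < r (Suc k)" "y (Suc k) \<le> v k" "v (Suc k) \<le> v k" for k
    using t(2)[of k] by (auto simp: Q_def r_def y_def v_def case_prod_beta)
  show thesis
  proof (rule that[of r y])
    show "strict_mono r"
      using Q(1) by (simp add: strict_mono_Suc_iff)
    show "0 \<le> y k" for k by (rule P(1))
    show "disjoint_seq y"
    proof (rule disjoint_seq_nonnegI[OF P(1)])
      fix j k :: nat assume "j < k"
      \<comment> \<open>A later \<open>y k\<close> lies below the remainder \<open>v i\<close> of
        the preceding step, hence below \<open>v j\<close>, which is disjoint from
        \<open>y j\<close>.\<close>
      then obtain i where i: "k = Suc i" "j \<le> i"
        by (metis less_imp_Suc_add le_add1)
      have "v i \<le> v j"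
        using Q(3) i(2) by (rule lift_Suc_antimono_le)
      with Q(2)[of i] have "y k \<le> v j"
        unfolding i(1) by (rule order_trans)
      then show "inf (y j) (y k) = 0"
        using P by (intro inf_eq_0_mono[OF P(4)[of j]]) auto
    qed
    have "norm (y k) \<le> norm u" for k
      by (rule norm_mono_pos[OF P(1,2)])
    then show "bounded (range y)"
      by (auto simp: bounded_iff)
    show "\<not> (\<lambda>k. dual_apply (f (r k)) (y k)) \<longlonglongrightarrow> 0"
      using LIMSEQ_le_const[of "\<lambda>k. dual_apply (f (r k)) (y k)" 0 "d / 2"] P(5) d(1) by force
  qed
qed

lemma disjoint_elements_for_disjoint_functionals:
  fixes f :: "nat \<Rightarrow> 'a::banach_lattice dual"
  assumes "\<And>n. 0 \<le> f n" "disjoint_seq f" "bounded (range f)" "\<not> f \<longlonglongrightarrow> 0"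
  obtains r y where "strict_mono r" "\<And>k. 0 \<le> y k" "disjoint_seq y" "bounded (range y)"
    "\<not> (\<lambda>k. dual_apply (f (r k)) (y k)) \<longlonglongrightarrow> 0"
proof (cases "\<forall>u\<ge>0. (\<lambda>n. dual_apply (f n) u) \<longlonglongrightarrow> 0")
  case True
  then show thesis
    using disjoint_elements_if_weak_star_null[OF assms(1,3) _ assms(4)] that by blast
next
  case False
  then show thesis
    using disjoint_elements_in_interval[OF assms(1-3)] that by blast
qed

section \<open>L-weak compactness\<close>

lemma solid_hull_solid: "solid A \<Longrightarrow> solid_hull A = A"
  by (auto simp: solid_def solid_hull_def)

text \<open>A solid set is its own solid hull and contains the moduli of its elements; moduli
  preserve disjointness and norms, so positive sequences suffice.\<close>

lemma L_weakly_compact_solid_iff: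
  fixes A :: "'a::banach_lattice set"
  assumes "bounded A" "solid A"
  shows "L_weakly_compact A \<longleftrightarrow>
    (\<forall>x. range x \<subseteq> A \<and> (\<forall>n. 0 \<le> x n) \<and> disjoint_seq x \<longrightarrow> x \<longlonglongrightarrow> 0)" (is "_ \<longleftrightarrow> ?R")
proof
  assume "L_weakly_compact A"
  then show ?R
    using assms by (auto simp: L_weakly_compact_def solid_hull_solid)
next
  assume R: ?R
  have "x \<longlonglongrightarrow> 0" if x: "disjoint_seq x" "range x \<subseteq> A" for x
  proof -
    have "\<bar>x n\<bar> \<in> A" for n
      using x assms(2) unfolding solid_def by (metis abs_idempotent order_refl range_subsetD)
    then have "(\<lambda>n. \<bar>x n\<bar>) \<longlonglongrightarrow> 0"
      using R disjoint_seq_abs[OF x(1)] by (auto simp: image_subset_iff)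
    then have "(\<lambda>n. norm \<bar>x n\<bar>) \<longlonglongrightarrow> 0"
      by (rule tendsto_norm_zero)
    then show ?thesis
      by (simp add: tendsto_norm_zero_iff)
  qed
  then show "L_weakly_compact A"
    using assms by (auto simp: L_weakly_compact_def solid_hull_solid)
qed

section \<open>Pairings of bounded with norm null sequences, and the two criteria\<close>

lemma dual_apply_tendsto_0_left:
  fixes f :: "nat \<Rightarrow> 'a::banach_lattice dual"
  assumes "bounded (range f)" "x \<longlonglongrightarrow> 0"
  shows "(\<lambda>n. dual_apply (f n) (x n)) \<longlonglongrightarrow> 0"
proof -
  obtain M where M: "\<And>n. norm (f n) \<le> M"
    using assms(1) by (auto simp: bounded_iff)
  have "\<forall>n. norm (dual_apply (f n) (x n)) \<le> M * norm (x n)"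
  proof
    show "norm (dual_apply (f n) (x n)) \<le> M * norm (x n)" for n
      using abs_dual_apply_le[of "f n" "x n"] mult_right_mono[OF M[of n] norm_ge_zero[of "x n"]]
      by simp
  qed
  then show ?thesis
    by (rule Lim_null_comparison[OF always_eventually])
      (rule tendsto_mult_right_zero[OF tendsto_norm_zero[OF assms(2)]])
qed

lemma dual_apply_tendsto_0_right:
  fixes f :: "nat \<Rightarrow> 'a::banach_lattice dual"
  assumes "bounded (range x)" "f \<longlonglongrightarrow> 0"
  shows "(\<lambda>n. dual_apply (f n) (x n)) \<longlonglongrightarrow> 0"
proof -
  obtain M where M: "\<And>n. norm (x n) \<le> M"
    using assms(1) by (auto simp: bounded_iff)
  have "\<forall>n. norm (dual_apply (f n) (x n)) \<le> norm (f n) * M"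
  proof
    show "norm (dual_apply (f n) (x n)) \<le> norm (f n) * M" for n
      using abs_dual_apply_le[of "f n" "x n"] mult_left_mono[OF M[of n] norm_ge_zero[of "f n"]]
      by simp
  qed
  then show ?thesis
    by (rule Lim_null_comparison[OF always_eventually])
      (rule tendsto_mult_left_zero[OF tendsto_norm_zero[OF assms(2)]])
qed

text \<open>The mode of convergence is a parameter \<open>null\<close>, because the argument uses
  only that disjoint sequences have it. Norming functionals turn the pairing into
  \<open>norm (x n)\<close>.\<close>

lemma L_weakly_compact_iff_disjoint_functionals:
  fixes A :: "'a::banach_lattice set" and null :: "(nat \<Rightarrow> 'a dual) \<Rightarrow> bool"
  assumes "bounded A" "solid A" and null: "\<And>f. disjoint_seq f \<Longrightarrow> null f"
  shows "L_weakly_compact A \<longleftrightarrow>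
    (\<forall>x f. range x \<subseteq> A \<and> (\<forall>n. 0 \<le> x n) \<and> disjoint_seq x \<and> bounded (range f) \<and> null f \<longrightarrow>
       (\<lambda>n. dual_apply (f n) (x n)) \<longlonglongrightarrow> 0)" (is "_ \<longleftrightarrow> ?R")
proof
  assume "L_weakly_compact A"
  then show ?R
    using L_weakly_compact_solid_iff[OF assms(1,2)] dual_apply_tendsto_0_left by blast
next
  assume R: ?R
  have "x \<longlonglongrightarrow> 0" if x: "range x \<subseteq> A" "\<forall>n. 0 \<le> x n" "disjoint_seq x" for x
  proof -
    obtain f :: "nat \<Rightarrow> 'a dual" where f: "disjoint_seq f" "bounded (range f)"
      "\<And>n. dual_apply (f n) (x n) = norm (x n)"
      using disjoint_norming_functionals[OF x(3)] x(2) by blast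
    then have "(\<lambda>n. dual_apply (f n) (x n)) \<longlonglongrightarrow> 0"
      using R x null by blast
    then show ?thesis
      by (simp add: f(3) tendsto_norm_zero_iff)
  qed
  then show "L_weakly_compact A"
    using L_weakly_compact_solid_iff[OF assms(1,2)] by blast
qed

text \<open>If \<open>f\<close> were not norm null, suitable disjoint elements along a subsequence
  would violate the criterion. They are paired with \<open>f \<circ> r\<close>, which is again a
  positive disjoint sequence in \<open>B\<close>.\<close>

lemma L_weakly_compact_dual_iff_disjoint_elements:
  fixes B :: "'a::banach_lattice dual set" and null :: "(nat \<Rightarrow> 'a) \<Rightarrow> bool"
  assumes "bounded B" "solid B" and null: "\<And>x. disjoint_seq x \<Longrightarrow> null x"
  shows "L_weakly_compact B \<longleftrightarrow>
    (\<forall>f x. range f \<subseteq> B \<and> (\<forall>n. 0 \<le> f n) \<and> disjoint_seq f \<and> bounded (range x) \<and> null x \<longrightarrow>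
       (\<lambda>n. dual_apply (f n) (x n)) \<longlonglongrightarrow> 0)" (is "_ \<longleftrightarrow> ?R")
proof
  assume "L_weakly_compact B"
  then show ?R
    using L_weakly_compact_solid_iff[OF assms(1,2)] dual_apply_tendsto_0_right by blast
next
  assume R: ?R
  have "f \<longlonglongrightarrow> 0" if f: "range f \<subseteq> B" "\<forall>n. 0 \<le> f n" "disjoint_seq f" for f
  proof (rule ccontr)
    assume "\<not> f \<longlonglongrightarrow> 0"
    moreover have "bounded (range f)"
      using assms(1) f(1) by (rule bounded_subset)
    ultimately obtain r y where r: "strict_mono r" and y: "disjoint_seq y" "bounded (range y)"
      and not_null: "\<not> (\<lambda>k. dual_apply (f (r k)) (y k)) \<longlonglongrightarrow> 0"
      using disjoint_elements_for_disjoint_functionals[of f] f by metis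
    have "range (f \<circ> r) \<subseteq> B" "\<forall>n. 0 \<le> (f \<circ> r) n" "disjoint_seq (f \<circ> r)"
      using f r by (auto intro: disjoint_seq_subseq)
    then have "(\<lambda>k. dual_apply ((f \<circ> r) k) (y k)) \<longlonglongrightarrow> 0"
      using R y null by blast
    with not_null show False
      by simp
  qed
  then show "L_weakly_compact B"
    using L_weakly_compact_solid_iff[OF assms(1,2)] by blast
qed

theorem theorem2p4:
  fixes A :: "'a::banach_lattice set" and B :: "'a dual set"
  assumes "bounded A" and "solid A" and "bounded B" and "solid B"
  shows
    "(order_continuous_norm TYPE('a) \<longrightarrow>
       (L_weakly_compact A \<longleftrightarrow>
          (\<forall>(x :: nat \<Rightarrow> 'a) (x' :: nat \<Rightarrow> 'a dual).
             range x \<subseteq> A \<and> (\<forall>n. 0 \<le> x n) \<and> disjoint_seq x \<and>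
             bounded (range x') \<and> uaw_star_null x' \<longrightarrow>
             (\<lambda>n. dual_apply (x' n) (x n)) \<longlonglongrightarrow> 0)) \<and>
       (L_weakly_compact A \<longleftrightarrow>
          (\<forall>(x :: nat \<Rightarrow> 'a) (x' :: nat \<Rightarrow> 'a dual).
             range x \<subseteq> A \<and> (\<forall>n. 0 \<le> x n) \<and> disjoint_seq x \<and>
             bounded (range x') \<and> uaw_null x' \<longrightarrow>
             (\<lambda>n. dual_apply (x' n) (x n)) \<longlonglongrightarrow> 0)) \<and>
       (L_weakly_compact A \<longleftrightarrow>
          (\<forall>(x :: nat \<Rightarrow> 'a) (x' :: nat \<Rightarrow> 'a dual).
             range x \<subseteq> A \<and> (\<forall>n. 0 \<le> x n) \<and> disjoint_seq x \<and>
             bounded (range x') \<and> uo_null x' \<longrightarrow>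
             (\<lambda>n. dual_apply (x' n) (x n)) \<longlonglongrightarrow> 0)))
     \<and>
     (order_continuous_norm TYPE('a dual) \<longrightarrow>
       (L_weakly_compact B \<longleftrightarrow>
          (\<forall>(x' :: nat \<Rightarrow> 'a dual) (x :: nat \<Rightarrow> 'a).
             range x' \<subseteq> B \<and> (\<forall>n. 0 \<le> x' n) \<and> disjoint_seq x' \<and>
             bounded (range x) \<and> uaw_null x \<longrightarrow>
             (\<lambda>n. dual_apply (x' n) (x n)) \<longlonglongrightarrow> 0)))"
  \<comment> \<open>Each equivalence instantiates \<open>null\<close> with one mode of convergence;
    \<open>disjoint_seq_uaw_null\<close> serves in the dual for the first part and in the space
    itself for the second.\<close>
  by (intro conjI impI L_weakly_compact_iff_disjoint_functionals
      L_weakly_compact_dual_iff_disjoint_elements assms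
      disjoint_seq_uaw_star_null disjoint_seq_uaw_null disjoint_seq_dual_uo_null)

end
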